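(* Let $X$ be the subordinate Brownian motion in $\mathbb R^d$, $d\ge1$, associated with a subordinator whose Laplace exponent $\phi$ is a complete Bernstein function with zero killing coefficient such that, for some $\alpha\in(0,2\wedge d)$ and some measurable $\ell:(0,\infty)\to(0,\infty)$ that is locally bounded above and below by positive constants and slowly varying at infinity, $\phi(\lambda)\asymp\lambda^{\alpha/2}\ell(\lambda)$ as $\lambda\to\infty$. In the case $d\le2$ assume further that there exists $\gamma\in[0,d/2)$ such that $\liminf_{\lambda\to0}\phi(\lambda)/\lambda^{\gamma}>0$. Then the Green function $G$ of $X$ satisfies $$G(x)\asymp\frac1{|x|^{d}\phi(|x|^{-2})}\asymp\frac1{|x|^{d-\alpha}\ell(|x|^{-2})},\qquad |x|\to0.$$
   Context: A Bernstein function is $\phi(\lambda)=a+b\lambda+\int_{(0,\infty)}(1-e^{-\lambda t})\,\mu(dt)$ on $(0,\infty)$ with $a,b\ge0$ and $\int(1\wedge t)\,\mu(dt)<\infty$; $a$ is the killing coefficient. It is a complete Bernstein function if $\mu$ has a completely monotone density. A subordinator $S=(S_t)_{t\ge0}$ is an increasing Lévy process with $S_0=0$; its Laplace exponent is given by $\mathbb E[e^{-\lambda S_t}]=e^{-t\phi(\lambda)}$. Let $B$ be a Brownian motion in $\mathbb R^d$ with transition density $p(t,x)=(4\pi t)^{-d/2}e^{-|x|^2/(4t)}$, independent of $S$. The subordinate Brownian motion is $X_t=B_{S_t}$, a Lévy process with characteristic exponent $\Phi(\xi)=\phi(|\xi|^2)$. Under the assumptions made here $X$ is transient, and the potential measure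 $U(A)=\mathbb E\int_0^\infty\mathbf 1_{\{S_t\in A\}}dt$ of $S$ has a completely monotone density $u$. The Green function of $X$ is $G(x)=\int_0^\infty p(t,x)u(t)\,dt$, i.e. $G(x,y)=G(y-x)$ is the density of the potential measure $A\mapsto\mathbb E_x\int_0^\infty\mathbf 1_{\{X_t\in A\}}dt$. $\ell$ is slowly varying at infinity if $\lim_{t\to\infty}\ell(\lambda t)/\ell(t)=1$ for every $\lambda>0$. Convention: $f\asymp g$ as $\lambda\to\infty$ (resp. as $|x|\to0$) means there is a constant $c>1$ with $c^{-1}\le f/g\le c$ for all $\lambda\ge1$ (resp. all $0<|x|\le1$). *)

theory Defs
  imports "HOL-Probability.Probability"
begin

definition completely_monotone :: "(real \<Rightarrow> real) \<Rightarrow> bool" where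
  "completely_monotone f \<longleftrightarrow>
     (\<forall>n. \<forall>t>0. (deriv ^^ n) f differentiable (at t) \<and> (- 1) ^ n * (deriv ^^ n) f t \<ge> 0)"

text \<open>The values of the density \<open>f\<close> outside of \<open>(0, \<infinity>)\<close> are irrelevant.\<close>

definition has_cm_density :: "real measure \<Rightarrow> (real \<Rightarrow> real) \<Rightarrow> bool" where
  "has_cm_density \<nu> f \<longleftrightarrow>
     completely_monotone f \<and> \<nu> = density lborel (\<lambda>t. ennreal (f t) * indicator {0<..} t)"

text \<open>Measures on \<open>(0, \<infinity>)\<close> are represented by Borel measures on the line for which
  \<open>(-\<infinity>, 0]\<close> is a null set.\<close>

definition bernstein :: "(real \<Rightarrow> real) \<Rightarrow> real \<Rightarrow> real \<Rightarrow> real measure \<Rightarrow> bool" where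
  "bernstein \<phi> a b \<mu> \<longleftrightarrow>
     a \<ge> 0 \<and> b \<ge> 0 \<and> sets \<mu> = sets borel \<and> emeasure \<mu> {..0} = 0 \<and>
     (\<integral>\<^sup>+t. ennreal (min 1 t) \<partial>\<mu>) < \<infinity> \<and>
     (\<forall>s>0. \<phi> s = a + b * s + (\<integral>t. (1 - exp (- s * t)) \<partial>\<mu>))"

definition complete_bernstein :: "(real \<Rightarrow> real) \<Rightarrow> real \<Rightarrow> real \<Rightarrow> real measure \<Rightarrow> bool" where
  "complete_bernstein \<phi> a b \<mu> \<longleftrightarrow> bernstein \<phi> a b \<mu> \<and> (\<exists>m. has_cm_density \<mu> m)"

text \<open>A process is a function of time and of the sample point; only times \<open>t \<ge> 0\<close> matter.
  A Levy process starts at \<open>0\<close>; stochastic continuity follows from the right-continuity of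
  the paths and the stationarity of the increments.\<close>

definition levy_process :: "'w measure \<Rightarrow> (real \<Rightarrow> 'w \<Rightarrow> 'b::euclidean_space) \<Rightarrow> bool" where
  "levy_process M X \<longleftrightarrow>
     prob_space M \<and>
     (\<forall>t\<ge>0. X t \<in> borel_measurable M) \<and>
     (AE \<omega> in M. X 0 \<omega> = 0) \<and>
     (\<forall>t :: nat \<Rightarrow> real. 0 \<le> t 0 \<and> mono t \<longrightarrow>
        (\<forall>n. prob_space.indep_vars M (\<lambda>_. borel)
               (\<lambda>i \<omega>. X (t (Suc i)) \<omega> - X (t i) \<omega>) {..<n})) \<and>
     (\<forall>s\<ge>0. \<forall>h\<ge>0. distr M borel (\<lambda>\<omega>. X (s + h) \<omega> - X s \<omega>) = distr M borel (X h)) \<and>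
     (AE \<omega> in M. \<forall>t\<ge>0.
        continuous (at_right t) (\<lambda>s. X s \<omega>) \<and>
        (t > 0 \<longrightarrow> (\<exists>l. ((\<lambda>s. X s \<omega>) \<longlongrightarrow> l) (at_left t))))"

definition subordinator :: "'w measure \<Rightarrow> (real \<Rightarrow> 'w \<Rightarrow> real) \<Rightarrow> bool" where
  "subordinator M S \<longleftrightarrow> levy_process M S \<and> (AE \<omega> in M. mono_on {0..} (\<lambda>t. S t \<omega>))"

definition laplace_exponent ::
  "'w measure \<Rightarrow> (real \<Rightarrow> 'w \<Rightarrow> real) \<Rightarrow> (real \<Rightarrow> real) \<Rightarrow> bool" where
  "laplace_exponent M S \<phi> \<longleftrightarrow>
     (\<forall>t\<ge>0. \<forall>s>0. (\<integral>\<omega>. exp (- s * S t \<omega>) \<partial>M) = exp (- t * \<phi> s))"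

text \<open>The heat kernel of the Laplacian itself (not of half of it): a Brownian motion at time
  \<open>t\<close> has variance \<open>2 t\<close> in each coordinate.\<close>

definition heat_kernel :: "real \<Rightarrow> 'a::euclidean_space \<Rightarrow> real" where
  "heat_kernel t x =
     (4 * pi * t) powr (- real DIM('a) / 2) * exp (- (norm x)\<^sup>2 / (4 * t))"

definition brownian_motion :: "'w measure \<Rightarrow> (real \<Rightarrow> 'w \<Rightarrow> 'a::euclidean_space) \<Rightarrow> bool" where
  "brownian_motion M B \<longleftrightarrow>
     levy_process M B \<and>
     (\<forall>t>0. distr M borel (B t) = density lborel (\<lambda>x. ennreal (heat_kernel t x))) \<and>
     (AE \<omega> in M. continuous_on {0..} (\<lambda>t. B t \<omega>))"

definition independent_processes ::
  "'w measure \<Rightarrow> (real \<Rightarrow> 'w \<Rightarrow> 'b::euclidean_space) \<Rightarrow>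
     (real \<Rightarrow> 'w \<Rightarrow> 'c::euclidean_space) \<Rightarrow> bool" where
  "independent_processes M X Y \<longleftrightarrow>
     prob_space.indep_set M
       (sets (vimage_algebra (space M) (\<lambda>\<omega>. \<lambda>t\<in>{0..}. X t \<omega>) (\<Pi>\<^sub>M t\<in>{0..}. borel)))
       (sets (vimage_algebra (space M) (\<lambda>\<omega>. \<lambda>t\<in>{0..}. Y t \<omega>) (\<Pi>\<^sub>M t\<in>{0..}. borel)))"

definition subordinate_brownian_motion ::
  "'w measure \<Rightarrow> (real \<Rightarrow> 'w \<Rightarrow> 'a::euclidean_space) \<Rightarrow> (real \<Rightarrow> 'w \<Rightarrow> real) \<Rightarrow>
     (real \<Rightarrow> 'w \<Rightarrow> 'a) \<Rightarrow> bool" where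
  "subordinate_brownian_motion M B S X \<longleftrightarrow>
     brownian_motion M B \<and> subordinator M S \<and> independent_processes M B S \<and>
     (\<forall>t\<ge>0. \<forall>\<omega>\<in>space M. X t \<omega> = B (S t \<omega>) \<omega>)"

definition potential_measure ::
  "'w measure \<Rightarrow> (real \<Rightarrow> 'w \<Rightarrow> 'b::euclidean_space) \<Rightarrow> 'b measure" where
  "potential_measure M X =
     measure_of UNIV (sets borel)
       (\<lambda>A. \<integral>\<^sup>+\<omega>. (\<integral>\<^sup>+t\<in>{0..}. indicator A (X t \<omega>) \<partial>lborel) \<partial>M)"

text \<open>The Green function \<open>G(x) = \<integral> p(t, x) U(dt)\<close> of the subordinate Brownian motion, where
  \<open>U\<close> is the potential measure of the subordinator \<open>S\<close>. When \<open>U\<close> has the completely monotone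
  density \<open>u\<close>, that is \<open>U(dt) = u(t) dt\<close>, this is \<open>\<integral> p(t, x) u(t) dt\<close>, see
  \<open>green_function_density\<close> below. As always for the Bochner integral, a divergent integral has the
  value \<open>0\<close>; a strictly positive lower bound on \<open>G(x)\<close> therefore includes its convergence.\<close>

definition green_function ::
  "'w measure \<Rightarrow> (real \<Rightarrow> 'w \<Rightarrow> real) \<Rightarrow> 'a::euclidean_space \<Rightarrow> real" where
  "green_function M S x = (LINT t:{0<..}|potential_measure M S. heat_kernel t x)"

definition slowly_varying :: "(real \<Rightarrow> real) \<Rightarrow> bool" where
  "slowly_varying l \<longleftrightarrow> (\<forall>s>0. ((\<lambda>t. l (s * t) / l t) \<longlongrightarrow> 1) at_top)"

definition locally_bounded_above_below :: "(real \<Rightarrow> real) \<Rightarrow> bool" where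
  "locally_bounded_above_below l \<longleftrightarrow>
     (\<forall>K. compact K \<and> K \<subseteq> {0<..} \<longrightarrow> (\<exists>c>0. \<exists>C>0. \<forall>t\<in>K. c \<le> l t \<and> l t \<le> C))"

definition comparable_on :: "'b set \<Rightarrow> ('b \<Rightarrow> real) \<Rightarrow> ('b \<Rightarrow> real) \<Rightarrow> bool" where
  "comparable_on A f g \<longleftrightarrow> (\<exists>c>1. \<forall>x\<in>A. inverse c \<le> f x / g x \<and> f x / g x \<le> c)"

lemma green_function_density:
  assumes "has_cm_density (potential_measure M S) u"
  shows "green_function M S x = (LBINT t:{0<..}. heat_kernel t x * u t)"
proof -
  have nonneg: "0 \<le> u t" and diff: "u differentiable (at t)" if "t > 0" for t
    using assms that unfolding has_cm_density_def completely_monotone_def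
    by (auto dest!: spec[of _ "0::nat"])
  have "continuous_on {0<..} u"
    using diff by (auto intro!: continuous_at_imp_continuous_on differentiable_imp_continuous_within)
  then have meas: "(\<lambda>t. indicator {0<..} t * u t) \<in> borel_measurable borel"
    using borel_measurable_continuous_on_indicator[of "{0<..}" u] by simp
  have eq: "potential_measure M S = density lborel (\<lambda>t. ennreal (indicator {0<..} t * u t))"
    using assms unfolding has_cm_density_def
    by (auto intro!: arg_cong[where f = "density lborel"] split: split_indicator)
  have "green_function M S x =
      (\<integral>t. (indicator {0<..} t * u t) *\<^sub>R (indicator {0<..} t *\<^sub>R heat_kernel t x) \<partial>lborel)"
    unfolding green_function_def set_lebesgue_integral_def eq
    by (rule integral_density)
      (use meas nonneg in \<open>auto simp: heat_kernel_def split: split_indicator\<close>)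
  also have "\<dots> = (LBINT t:{0<..}. heat_kernel t x * u t)"
    unfolding set_lebesgue_integral_def
    by (intro Bochner_Integration.integral_cong) (auto split: split_indicator)
  finally show ?thesis .
qed

end

theory Submission
  imports Defs
begin

text \<open>Let \<open>U\<close> be the potential measure of \<open>S\<close>. Everything rests on its Laplace transform
\<open>\<integral> exp (- s t) U(dt) = 1 / \<phi>(s)\<close> (\<open>nn_integral_exp_potential_measure\<close>). The Green function is the integral of \<open>t \<mapsto> p(t, x)\<close>, and this
function is sandwiched between combinations of exponentials, so that \<open>G(x)\<close> is estimated by values
of \<open>1 / \<phi>\<close> alone. Write \<open>r = |x|\<close> and \<open>s = 1 / r\<^sup>2 \<ge> 1\<close>; the target is \<open>G(x) \<asymp> 1 / (r^d \<phi>(s))\<close>.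

\<^bold>\<open>Upper bound.\<close> On the dyadic layer \<open>t \<approx> 2^k r\<^sup>2\<close> the heat kernel is at most a constant times
\<open>r^(-d) 2^(-kd/2)\<close>, and \<open>exp (- 2^(-k) s t)\<close> is bounded below there; for \<open>t \<le> r\<^sup>2\<close> the Gaussian factor
gives the same bound with \<open>k = 0\<close>. Hence \<open>G(x) \<le> C r^(-d) \<Sum>k. 2^(-kd/2) / \<phi>(2^(-k) s)\<close>. If
\<open>\<phi>(s) \<le> K (s / s')^\<beta> \<phi>(s')\<close> for all \<open>s' \<le> s\<close> with some \<open>\<beta> < d/2\<close>, the series is dominated by a
geometric one, which leaves \<open>C / (r^d \<phi>(s))\<close> (\<open>heat_kernel_integral_upper\<close>).

\<^bold>\<open>Lower bound.\<close> The mass that \<open>exp (- s t) U(dt)\<close> gives to small \<open>t\<close> (below \<open>1 / (2^m s)\<close>) is at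
most \<open>e / \<phi>(2^m s)\<close>, and the mass given to large \<open>t\<close> (above \<open>K / s\<close>) is at most
\<open>exp (- K/2) / \<phi>(s/2)\<close>. For large \<open>m\<close> and \<open>K\<close> each is at most a quarter of the total \<open>1 / \<phi>(s)\<close>, so
half of the total sits on the middle range, where \<open>p(t, x)\<close> is at least a constant times \<open>r^(-d)\<close>
(\<open>heat_kernel_integral_lower\<close>).

\<^bold>\<open>Growth of \<open>\<phi>\<close>.\<close> A Bernstein function \<open>\<phi>\<close> is increasing, and \<open>\<phi>(s)/s\<close> is decreasing. Slow variation of \<open>l\<close> is applied only along the sequences \<open>2^k t\<close>: since \<open>l(2t)/l(t)\<close> tends
to \<open>1\<close>, \<open>l(2^k t)/l(t)\<close> lies between \<open>p^(-k)\<close> and \<open>p^k\<close> for any given \<open>p > 1\<close> and large \<open>t\<close>.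
Monotonicity of \<open>\<phi>\<close> fills the gaps between dyadic points, and comparability carries the bounds from
\<open>s^(\<alpha>/2) l(s)\<close> over to \<open>\<phi>\<close>. This yields both the exponent \<open>\<beta> < d/2\<close> of the upper bound and the
\<open>m\<close> of the lower bound (\<open>bernstein_dyadic_multiple\<close>). Below \<open>s = 1\<close> the growth of \<open>\<phi>\<close> is controlled by
\<open>\<phi>(s) \<ge> c s^\<gamma>\<close>, with \<open>\<gamma> = 1\<close> if \<open>d \<ge> 3\<close> (\<open>bernstein_growth_from_zero\<close>).

The second comparison is the hypothesis on \<open>\<phi>\<close> at the argument \<open>s = 1 / r\<^sup>2\<close>.\<close>

section \<open>The potential measure and its Laplace transform\<close>

text \<open>The process is the pointwise limit of its values at the next grid point of mesh \<open>1 / (n + 1)\<close>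
strictly to the right of \<open>t\<close>; each approximation takes only countably many times into account.\<close>

lemma right_continuous_process_measurable:
  fixes X :: "real \<Rightarrow> 'w \<Rightarrow> 'b::metric_space"
  assumes meas: "\<And>t. X t \<in> borel_measurable M"
    and cont: "\<And>t \<omega>. \<omega> \<in> space M \<Longrightarrow> continuous (at_right t) (\<lambda>s. X s \<omega>)"
  shows "(\<lambda>p. X (fst p) (snd p)) \<in> borel_measurable (borel \<Otimes>\<^sub>M M)"
proof (rule borel_measurable_LIMSEQ_metric)
  fix n :: nat
  show "(\<lambda>p. X ((of_int \<lfloor>real (Suc n) * fst p\<rfloor> + 1) / real (Suc n)) (snd p))
      \<in> borel_measurable (borel \<Otimes>\<^sub>M M)"
    by (rule measurable_compose_countable[where f = "\<lambda>k p. X ((of_int k + 1) / real (Suc n)) (snd p)"])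
      (use meas in measurable)
next
  fix p :: "real \<times> 'w" assume p: "p \<in> space (borel \<Otimes>\<^sub>M M)"
  define t where "t = fst p"
  define q where "q = (\<lambda>n. (of_int \<lfloor>real (Suc n) * t\<rfloor> + 1) / real (Suc n))"
  have q: "t < q n" "q n \<le> t + 1 / real (Suc n)" for n
  proof -
    have "real (Suc n) * t < of_int \<lfloor>real (Suc n) * t\<rfloor> + 1" by linarith
    then show "t < q n" by (simp add: q_def field_simps)
    have "of_int \<lfloor>real (Suc n) * t\<rfloor> \<le> real (Suc n) * t" by linarith
    then have "q n \<le> (real (Suc n) * t + 1) / real (Suc n)"
      unfolding q_def by (intro divide_right_mono) auto
    then show "q n \<le> t + 1 / real (Suc n)" by (simp add: add_divide_distrib)
  qed
  have "(\<lambda>n. t + 1 / real (Suc n)) \<longlonglongrightarrow> t + 0"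
    by (intro tendsto_add tendsto_const LIMSEQ_Suc[OF lim_1_over_n])
  then have "q \<longlonglongrightarrow> t"
    by (intro tendsto_sandwich[of "\<lambda>_. t" q sequentially "\<lambda>n. t + 1 / real (Suc n)"])
      (use q in \<open>auto intro!: always_eventually less_imp_le\<close>)
  then have "filterlim q (at_right t) sequentially"
    unfolding filterlim_at using q(1) by (auto intro!: always_eventually)
  moreover have "((\<lambda>s. X s (snd p)) \<longlongrightarrow> X t (snd p)) (at_right t)"
    using cont[of "snd p" t] p by (simp add: continuous_within space_pair_measure mem_Times_iff)
  ultimately have "(\<lambda>n. X (q n) (snd p)) \<longlonglongrightarrow> X t (snd p)"
    by (rule filterlim_compose[rotated])
  then show "(\<lambda>n. X ((of_int \<lfloor>real (Suc n) * fst p\<rfloor> + 1) / real (Suc n)) (snd p))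
      \<longlonglongrightarrow> X (fst p) (snd p)"
    by (simp add: q_def t_def)
qed

text \<open>The potential measure is declared through \<open>measure_of\<close>, which yields the zero measure unless
the set function is countably additive. That it is so follows from Tonelli's theorem, which needs joint
measurability in time and sample point. The paths are right-continuous only almost surely, so the proof
works with a modification \<open>Y\<close> that vanishes on the exceptional null set, and identifies the potential
measure with the image \<open>D\<close> under \<open>Y\<close> of the product of Lebesgue measure on \<open>[0, \<infinity>)\<close> with \<open>M\<close>.\<close>

lemma
  fixes X :: "real \<Rightarrow> 'w \<Rightarrow> 'b::euclidean_space"
  assumes "levy_process M X"
  shows sets_potential_measure: "sets (potential_measure M X) = sets borel"
    and nn_integral_potential_measure: "f \<in> borel_measurable borel \<Longrightarrow>
      (\<integral>\<^sup>+x. f x \<partial>potential_measure M X) =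
      (\<integral>\<^sup>+t. (\<integral>\<^sup>+\<omega>. f (X t \<omega>) \<partial>M) * indicator {0..} t \<partial>lborel)"
proof -
  interpret prob_space M using assms by (simp add: levy_process_def)
  have X_meas: "X t \<in> borel_measurable M" if "t \<ge> 0" for t
    using assms that by (simp add: levy_process_def)
  have "AE \<omega> in M. \<forall>t\<ge>0. continuous (at_right t) (\<lambda>s. X s \<omega>)"
  proof -
    have "AE \<omega> in M. \<forall>t\<ge>0. continuous (at_right t) (\<lambda>s. X s \<omega>) \<and>
        (t > 0 \<longrightarrow> (\<exists>l. ((\<lambda>s. X s \<omega>) \<longlongrightarrow> l) (at_left t)))"
      using assms unfolding levy_process_def by (elim conjE)
    then show ?thesis by eventually_elim blast
  qed
  then obtain N where N: "N \<in> null_sets M"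
      "\<And>\<omega> t. \<omega> \<in> space M - N \<Longrightarrow> t \<ge> 0 \<Longrightarrow> continuous (at_right t) (\<lambda>s. X s \<omega>)"
    by (elim AE_E) (auto simp: null_sets_def)
  define Y where "Y = (\<lambda>t \<omega>. if \<omega> \<in> N then 0 else X (max 0 t) \<omega>)"
  have [measurable]: "N \<in> sets M" using N(1) by auto
  have Y_meas: "Y t \<in> borel_measurable M" for t
    unfolding Y_def using X_meas[of "max 0 t"] by measurable
  have Y_cont: "continuous (at_right t) (\<lambda>s. Y s \<omega>)" if "\<omega> \<in> space M" for t \<omega>
  proof (cases "\<omega> \<in> N")
    case False
    have "((\<lambda>s. X (max 0 s) \<omega>) \<longlongrightarrow> X (max 0 t) \<omega>) (at_right t)"
    proof (cases "t \<ge> 0")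
      case True
      then have "((\<lambda>s. X s \<omega>) \<longlongrightarrow> X t \<omega>) (at_right t)"
        using N(2) that False by (simp add: continuous_within)
      then show ?thesis
        by (rule Lim_transform_eventually[THEN tendsto_eq_rhs])
          (use True in \<open>auto simp: eventually_at_filter max_def\<close>)
    next
      case neg: False
      have "\<forall>\<^sub>F s in at_right t. X 0 \<omega> = X (max 0 s) \<omega>"
        using neg by (intro eventually_at_rightI[of t 0]) (auto simp: max_def)
      then show ?thesis using neg
        by (intro Lim_transform_eventually[OF tendsto_const[of "X 0 \<omega>"], THEN tendsto_eq_rhs])
          (auto simp: max_def)
    qed
    then show ?thesis using False by (simp add: continuous_within Y_def)
  qed (simp add: Y_def)
  have [measurable]: "(\<lambda>p. Y (fst p) (snd p)) \<in> borel_measurable (borel \<Otimes>\<^sub>M M)"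
    using Y_meas Y_cont by (rule right_continuous_process_measurable)
  have Y_eq: "AE \<omega> in M. \<forall>t\<ge>0. Y t \<omega> = X t \<omega>"
    using AE_not_in[OF N(1)] by eventually_elim (auto simp: Y_def)
  define P where "P = density (lborel \<Otimes>\<^sub>M M) (\<lambda>p. indicator {0::real..} (fst p))"
  interpret LM: pair_sigma_finite "lborel :: real measure" M ..
  define D where "D = distr P borel (\<lambda>p. Y (fst p) (snd p))"
  have D: "(\<integral>\<^sup>+x. f x \<partial>D) = (\<integral>\<^sup>+t. (\<integral>\<^sup>+\<omega>. f (X t \<omega>) \<partial>M) * indicator {0..} t \<partial>lborel)"
      "(\<integral>\<^sup>+x. f x \<partial>D) = (\<integral>\<^sup>+\<omega>. (\<integral>\<^sup>+t. f (X t \<omega>) * indicator {0..} t \<partial>lborel) \<partial>M)"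
    if [measurable]: "f \<in> borel_measurable borel" for f :: "'b \<Rightarrow> ennreal"
  proof -
    have 1: "(\<integral>\<^sup>+x. f x \<partial>D) =
        (\<integral>\<^sup>+p. f (Y (fst p) (snd p)) * indicator {0..} (fst p) \<partial>(lborel \<Otimes>\<^sub>M M))"
      unfolding D_def P_def
      by (subst nn_integral_distr, measurable, subst nn_integral_density, measurable)
        (simp add: mult.commute)
    also have "\<dots> = (\<integral>\<^sup>+t. (\<integral>\<^sup>+\<omega>. f (Y t \<omega>) * indicator {0..} t \<partial>M) \<partial>lborel)"
      by (subst nn_integral_fst[symmetric]) auto
    also have "\<dots> = (\<integral>\<^sup>+t. (\<integral>\<^sup>+\<omega>. f (X t \<omega>) \<partial>M) * indicator {0..} t \<partial>lborel)"
      by (intro nn_integral_cong)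
        (use Y_eq in \<open>auto split: split_indicator intro!: nn_integral_cong_AE elim!: eventually_mono\<close>)
    finally show "(\<integral>\<^sup>+x. f x \<partial>D) = (\<integral>\<^sup>+t. (\<integral>\<^sup>+\<omega>. f (X t \<omega>) \<partial>M) * indicator {0..} t \<partial>lborel)" .
    note 1
    also have "(\<integral>\<^sup>+p. f (Y (fst p) (snd p)) * indicator {0..} (fst p) \<partial>(lborel \<Otimes>\<^sub>M M)) =
        (\<integral>\<^sup>+\<omega>. (\<integral>\<^sup>+t. f (Y t \<omega>) * indicator {0..} t \<partial>lborel) \<partial>M)"
      by (subst LM.nn_integral_snd[symmetric]) auto
    also have "\<dots> = (\<integral>\<^sup>+\<omega>. (\<integral>\<^sup>+t. f (X t \<omega>) * indicator {0..} t \<partial>lborel) \<partial>M)"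
      by (rule nn_integral_cong_AE)
        (use Y_eq in \<open>auto split: split_indicator intro!: nn_integral_cong elim!: eventually_mono\<close>)
    finally show "(\<integral>\<^sup>+x. f x \<partial>D) = (\<integral>\<^sup>+\<omega>. (\<integral>\<^sup>+t. f (X t \<omega>) * indicator {0..} t \<partial>lborel) \<partial>M)" .
  qed
  have "potential_measure M X = measure_of UNIV (sets borel) (emeasure D)"
    unfolding potential_measure_def
  proof (rule measure_of_eq)
    fix A :: "'b set" assume "A \<in> sigma_sets UNIV (sets borel)"
    then have A: "A \<in> sets borel" by (metis sets.sigma_sets_eq space_borel)
    then have "emeasure D A = (\<integral>\<^sup>+x. indicator A x \<partial>D)" by (simp add: D_def)
    also have "\<dots> = (\<integral>\<^sup>+\<omega>. (\<integral>\<^sup>+t. indicator A (X t \<omega>) * indicator {0..} t \<partial>lborel) \<partial>M)"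
      using A by (intro D(2)) auto
    finally show "(\<integral>\<^sup>+\<omega>. (\<integral>\<^sup>+t\<in>{0..}. indicator A (X t \<omega>) \<partial>lborel) \<partial>M) = emeasure D A" by simp
  qed simp
  also have "\<dots> = D"
    using measure_of_of_measure[of D] by (simp add: D_def)
  finally have eq: "potential_measure M X = D" .
  show "sets (potential_measure M X) = sets borel" by (simp add: eq D_def)
  show "f \<in> borel_measurable borel \<Longrightarrow> (\<integral>\<^sup>+x. f x \<partial>potential_measure M X) =
      (\<integral>\<^sup>+t. (\<integral>\<^sup>+\<omega>. f (X t \<omega>) \<partial>M) * indicator {0..} t \<partial>lborel)"
    unfolding eq by (rule D(1))
qed

lemma subordinator_nonneg:
  assumes "subordinator M S" "t \<ge> 0"
  shows "AE \<omega> in M. 0 \<le> S t \<omega>"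
proof -
  have "AE \<omega> in M. mono_on {0..} (\<lambda>t. S t \<omega>)" "AE \<omega> in M. S 0 \<omega> = 0"
    using assms by (auto simp: subordinator_def levy_process_def)
  then show ?thesis
  proof eventually_elim
    case (elim \<omega>)
    then show ?case using mono_onD[of "{0..}" "\<lambda>t. S t \<omega>" 0 t] assms(2) by auto
  qed
qed

lemma AE_potential_measure_nonneg:
  assumes "subordinator M S"
  shows "AE t in potential_measure M S. 0 \<le> t"
proof -
  have levy: "levy_process M S" using assms by (simp add: subordinator_def)
  have "(\<integral>\<^sup>+t. indicator {..<0} t \<partial>potential_measure M S) = 
      (\<integral>\<^sup>+t. (\<integral>\<^sup>+\<omega>. indicator {..<0} (S t \<omega>) \<partial>M) * indicator {0..} t \<partial>lborel)"
    by (intro nn_integral_potential_measure[OF levy]) auto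
  also have "\<dots> = (\<integral>\<^sup>+(t::real). 0 \<partial>lborel)"
  proof (intro nn_integral_cong)
    fix t :: real
    have "(\<integral>\<^sup>+\<omega>. indicator {..<0} (S t \<omega>) \<partial>M) = (\<integral>\<^sup>+\<omega>. 0 \<partial>M)" if "t \<ge> 0"
      using subordinator_nonneg[OF assms that] by (intro nn_integral_cong_AE) auto
    then show "(\<integral>\<^sup>+\<omega>. indicator {..<0} (S t \<omega>) \<partial>M) * indicator {0..} t = (0::ennreal)"
      by (auto split: split_indicator)
  qed
  finally have "emeasure (potential_measure M S) {..<0} = 0"
    by (simp add: sets_potential_measure[OF levy])
  then show ?thesis
    by (intro AE_I[of _ _ "{..<0}"]) (auto simp: sets_potential_measure[OF levy])
qed

text \<open>By Tonelli the transform is \<open>\<integral> exp (- t \<phi>(s)) dt\<close> over \<open>[0, \<infinity>)\<close>.\<close>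

lemma nn_integral_exp_potential_measure:
  assumes "subordinator M S" "laplace_exponent M S \<phi>" "s > 0" "\<phi> s > 0"
  shows "(\<integral>\<^sup>+t. ennreal (exp (- s * t)) \<partial>potential_measure M S) = ennreal (1 / \<phi> s)"
proof -
  have levy: "levy_process M S" using assms(1) by (simp add: subordinator_def)
  have inner: "(\<integral>\<^sup>+\<omega>. ennreal (exp (- s * S t \<omega>)) \<partial>M) = ennreal (exp (- t * \<phi> s))"
    if "t \<ge> 0" for t
  proof -
    have int: "(\<integral>\<omega>. exp (- s * S t \<omega>) \<partial>M) = exp (- t * \<phi> s)"
      using assms that by (simp add: laplace_exponent_def)
    then have "integrable M (\<lambda>\<omega>. exp (- s * S t \<omega>))"
      by (metis exp_not_eq_zero not_integrable_integral_eq)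
    from nn_integral_eq_integral[OF this] int show ?thesis by simp
  qed
  have "(\<integral>\<^sup>+t. ennreal (exp (- s * t)) \<partial>potential_measure M S) =
      (\<integral>\<^sup>+t. (\<integral>\<^sup>+\<omega>. ennreal (exp (- s * S t \<omega>)) \<partial>M) * indicator {0..} t \<partial>lborel)"
    by (rule nn_integral_potential_measure[OF levy]) simp
  also have "\<dots> = (\<integral>\<^sup>+t. ennreal (exp (- t * \<phi> s)) * indicator {0..} t \<partial>lborel)"
    using inner by (intro nn_integral_cong) (auto split: split_indicator)
  also have "\<dots> = ennreal (0 - (- exp (- 0 * \<phi> s) / \<phi> s))"
  proof (rule nn_integral_FTC_atLeast)
    show "((\<lambda>t. - exp (- t * \<phi> s) / \<phi> s) \<longlongrightarrow> 0) at_top"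
    proof -
      have "filterlim (\<lambda>t. - t * \<phi> s) at_bot at_top"
        using assms(4) by (simp add: filterlim_uminus_at_bot
            filterlim_at_top_mult_tendsto_pos[OF tendsto_const] filterlim_ident mult.commute)
      then have "((\<lambda>t. exp (- t * \<phi> s)) \<longlongrightarrow> 0) at_top"
        by (rule filterlim_compose[OF exp_at_bot])
      from tendsto_divide_zero[OF tendsto_minus[OF this, simplified], of "\<phi> s"]
      show ?thesis by simp
    qed
    show "((\<lambda>t. - exp (- t * \<phi> s) / \<phi> s) has_real_derivative exp (- t * \<phi> s)) (at t)" for t
      using assms(4) by (auto intro!: derivative_eq_intros)
  qed auto
  finally show ?thesis by simp
qed

section \<open>Bernstein functions\<close>

lemma bernstein_integrable:
  assumes "bernstein \<phi> a b \<mu>" "s > 0"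
  shows "integrable \<mu> (\<lambda>t. 1 - exp (- s * t))"
    and "AE t in \<mu>. t > 0"
proof -
  have sets[measurable_cong]: "sets \<mu> = sets borel" and fin: "(\<integral>\<^sup>+t. ennreal (min 1 t) \<partial>\<mu>) < \<infinity>"
    using assms by (auto simp: bernstein_def)
  show pos: "AE t in \<mu>. t > 0"
    using assms by (intro AE_I[of _ _ "{..0}"]) (auto simp: bernstein_def)
  show "integrable \<mu> (\<lambda>t. 1 - exp (- s * t))"
  proof (rule integrableI_bounded)
    have "(\<integral>\<^sup>+t. ennreal (norm (1 - exp (- s * t))) \<partial>\<mu>) \<le>
        (\<integral>\<^sup>+t. ennreal (max 1 s) * ennreal (min 1 t) \<partial>\<mu>)"
      using pos
    proof (intro nn_integral_mono_AE, eventually_elim)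
      case (elim t)
      have st: "0 < s * t" using elim assms(2) by simp
      have "1 - exp (- s * t) \<le> s * t" using exp_ge_add_one_self[of "- s * t"] by simp
      also have "s * t \<le> max 1 s * t" using elim by (intro mult_right_mono) auto
      finally have "1 - exp (- s * t) \<le> max 1 s * t" .
      moreover have "1 - exp (- s * t) \<le> max 1 s"
        using exp_gt_zero[of "- s * t"] by linarith
      ultimately have "1 - exp (- s * t) \<le> max 1 s * min 1 t" by (simp add: min_def)
      moreover have "norm (1 - exp (- s * t)) = 1 - exp (- s * t)" using st by simp
      ultimately show ?case by (simp add: ennreal_mult[symmetric] ennreal_leI elim less_imp_le)
    qed
    also have "\<dots> = ennreal (max 1 s) * (\<integral>\<^sup>+t. ennreal (min 1 t) \<partial>\<mu>)"
      by (rule nn_integral_cmult) measurable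
    also have "\<dots> < \<infinity>" using fin by (simp add: ennreal_mult_less_top)
    finally show "(\<integral>\<^sup>+t. ennreal (norm (1 - exp (- s * t))) \<partial>\<mu>) < \<infinity>" .
  qed measurable
qed

lemma bernstein_mono:
  assumes "bernstein \<phi> a b \<mu>" "0 < s" "s \<le> t"
  shows "\<phi> s \<le> \<phi> t"
proof -
  have "(\<integral>x. 1 - exp (- s * x) \<partial>\<mu>) \<le> (\<integral>x. 1 - exp (- t * x) \<partial>\<mu>)"
  proof (rule integral_mono_AE)
    show "AE x in \<mu>. 1 - exp (- s * x) \<le> 1 - exp (- t * x)"
      using bernstein_integrable(2)[OF assms(1,2)]
      by eventually_elim (use assms in \<open>simp add: mult_right_mono\<close>)
  qed (use assms in \<open>intro bernstein_integrable(1)[OF assms(1)]; simp\<close>)+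
  moreover have "b * s \<le> b * t" using assms by (auto simp: bernstein_def intro: mult_left_mono)
  ultimately show ?thesis using assms by (simp add: bernstein_def)
qed

text \<open>The function \<open>\<phi>\<close> is concave with \<open>\<phi>(0+) \<ge> 0\<close>; in the integral this is the convexity of
\<open>exp\<close> between \<open>0\<close> and \<open>- s x\<close>. It shows that a fixed factor in the argument of \<open>\<phi>\<close> costs only a constant.\<close>

lemma bernstein_scale:
  assumes "bernstein \<phi> a b \<mu>" "0 < c" "c \<le> 1" "0 < s"
  shows "c * \<phi> s \<le> \<phi> (c * s)"
proof -
  have "(\<integral>x. c * (1 - exp (- s * x)) \<partial>\<mu>) \<le> (\<integral>x. 1 - exp (- (c * s) * x) \<partial>\<mu>)"
  proof (rule integral_mono)
    show "c * (1 - exp (- s * x)) \<le> 1 - exp (- (c * s) * x)" for x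
      using convex_onD[OF exp_convex, of c 0 "- s * x"] assms by (simp add: algebra_simps)
  qed (use assms in \<open>intro integrable_mult_right bernstein_integrable(1)[OF assms(1)]; simp\<close>)+
  then have "c * (\<integral>x. 1 - exp (- s * x) \<partial>\<mu>) \<le> (\<integral>x. 1 - exp (- (c * s) * x) \<partial>\<mu>)"
    by simp
  moreover have "c * a \<le> a" using assms by (auto simp: bernstein_def mult_left_le_one_le)
  ultimately show ?thesis using assms by (simp add: bernstein_def algebra_simps)
qed

lemma bernstein_pos:
  assumes "bernstein \<phi> a b \<mu>" "\<phi> 1 > 0" "s > 0"
  shows "\<phi> s > 0"
proof (cases "s \<le> 1")
  case True
  then have "s * \<phi> 1 \<le> \<phi> s" using bernstein_scale[OF assms(1), of s 1] assms by simp
  then show ?thesis using mult_pos_pos[OF assms(3,2)] by linarith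
next
  case False
  then show ?thesis using bernstein_mono[OF assms(1), of 1 s] assms by simp
qed

section \<open>Comparable functions\<close>

lemma comparable_onE:
  assumes "comparable_on A f g" and "\<And>x. x \<in> A \<Longrightarrow> g x > 0"
  obtains c where "c > 1" "\<And>x. x \<in> A \<Longrightarrow> f x \<le> c * g x" "\<And>x. x \<in> A \<Longrightarrow> g x \<le> c * f x"
    "\<And>x. x \<in> A \<Longrightarrow> f x > 0"
proof -
  obtain c where c: "c > 1" "\<And>x. x \<in> A \<Longrightarrow> inverse c \<le> f x / g x \<and> f x / g x \<le> c"
    using assms(1) by (auto simp: comparable_on_def)
  have *: "f x \<le> c * g x" "g x \<le> c * f x" if "x \<in> A" for x
    using c(2)[OF that] assms(2)[OF that] c(1) by (auto simp: field_simps)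
  moreover have "f x > 0" if "x \<in> A" for x
  proof -
    have "0 < c * f x" using *(2)[OF that] assms(2)[OF that] by linarith
    then show ?thesis using c(1) by (simp add: zero_less_mult_iff)
  qed
  ultimately show thesis using that c(1) by blast
qed

lemma comparable_onI:
  assumes "\<And>x. x \<in> A \<Longrightarrow> g x > 0" "\<And>x. x \<in> A \<Longrightarrow> f x \<le> c * g x" "\<And>x. x \<in> A \<Longrightarrow> g x \<le> c' * f x"
    and "c' > 0"
  shows "comparable_on A f g"
  unfolding comparable_on_def
proof (intro exI[of _ "max 2 (max c c')"] conjI ballI)
  fix x assume x: "x \<in> A"
  have "f x / g x \<le> c" using assms(1,2)[OF x] by (simp add: divide_le_eq)
  then show "f x / g x \<le> max 2 (max c c')" by simp
  have "inverse (max 2 (max c c')) \<le> inverse c'" using assms(4) by (intro le_imp_inverse_le) auto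
  also have "\<dots> \<le> f x / g x" using assms(1,3)[OF x] assms(4) by (simp add: field_simps)
  finally show "inverse (max 2 (max c c')) \<le> f x / g x" .
qed simp

section \<open>Growth of Bernstein functions of regular variation\<close>

lemma dyadic_bracket:
  fixes v :: real
  assumes "v \<ge> 1"
  obtains k :: nat where "v \<le> 2 ^ k" "2 ^ k \<le> 2 * v"
proof -
  define k where "k = nat \<lceil>log 2 v\<rceil>"
  have k: "log 2 v \<le> real k" "real k \<le> log 2 v + 1"
    using zero_le_log_cancel_iff[of 2 v] assms unfolding k_def by linarith+
  have "v = 2 powr log 2 v" using assms by simp
  also have "\<dots> \<le> 2 powr real k" using k by simp
  finally have 1: "v \<le> 2 ^ k" by (simp add: powr_realpow)
  have "2 ^ k = 2 powr real k" by (simp add: powr_realpow)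
  also have "\<dots> \<le> 2 powr (log 2 v + 1)" using k by simp
  also have "\<dots> = 2 * v" using assms by (simp add: powr_add)
  finally show ?thesis using that 1 by blast
qed

text \<open>Iterating \<open>l(2t) / l(t) \<in> (1/p, p)\<close>, which holds for \<open>t \<ge> T\<close>. The threshold \<open>T\<close> serves
all \<open>k\<close> at once because doubling leads from \<open>t \<ge> T\<close> to arguments above \<open>T\<close> again.\<close>

lemma slowly_varying_dyadic:
  assumes "slowly_varying l" and pos: "\<And>t. t > 0 \<Longrightarrow> l t > 0" and "p > 1"
  obtains T where "T \<ge> 1"
    "\<And>t k. t \<ge> T \<Longrightarrow> l (2 ^ k * t) \<le> p ^ k * l t"
    "\<And>t k. t \<ge> T \<Longrightarrow> l t \<le> p ^ k * l (2 ^ k * t)"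
proof -
  have lim: "((\<lambda>t. l (2 * t) / l t) \<longlongrightarrow> 1) at_top"
    using assms(1) by (simp add: slowly_varying_def)
  have "inverse p < 1" using assms(3) by (simp add: inverse_less_1_iff)
  then have "\<forall>\<^sub>F t in at_top. inverse p < l (2 * t) / l t \<and> l (2 * t) / l t < p"
    using order_tendstoD[OF lim] assms(3) by (auto intro: eventually_conj)
  then obtain T0 where T0: "\<And>t. t \<ge> T0 \<Longrightarrow> inverse p < l (2 * t) / l t \<and> l (2 * t) / l t < p"
    by (auto simp: eventually_at_top_linorder)
  define T where "T = max 1 T0"
  have step: "l (2 * t) \<le> p * l t" "l t \<le> p * l (2 * t)" if "t \<ge> T" for t
    using T0[of t] pos[of t] that assms(3) by (auto simp: T_def field_simps)
  have big: "2 ^ k * t \<ge> T" if "t \<ge> T" for t k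
  proof -
    have "1 * t \<le> 2 ^ k * t" using that by (intro mult_right_mono) (auto simp: T_def)
    then show ?thesis using that by simp
  qed
  have "l (2 ^ k * t) \<le> p ^ k * l t \<and> l t \<le> p ^ k * l (2 ^ k * t)" if "t \<ge> T" for t k
  proof (induction k)
    case (Suc k)
    have "l (2 ^ Suc k * t) \<le> p * l (2 ^ k * t)"
      using step(1)[OF big[OF that], of k] by (simp add: mult.assoc)
    also have "\<dots> \<le> p * (p ^ k * l t)" using Suc assms(3) by (intro mult_left_mono) auto
    finally have 1: "l (2 ^ Suc k * t) \<le> p ^ Suc k * l t" by (simp add: mult.assoc)
    have "l t \<le> p ^ k * l (2 ^ k * t)" using Suc by simp
    also have "\<dots> \<le> p ^ k * (p * l (2 * (2 ^ k * t)))"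
      using step(2)[OF big[OF that], of k] assms(3) by (intro mult_left_mono) auto
    finally have 2: "l t \<le> p ^ Suc k * l (2 ^ Suc k * t)" by (simp add: ac_simps)
    from 1 2 show ?case by simp
  qed simp
  then show thesis using that[of T] by (auto simp: T_def)
qed

text \<open>A Potter-type bound along dyadic multiples. The bound for \<open>l\<close> starts at \<open>T\<close> only; applying it at
\<open>T s\<close> instead of \<open>s\<close> makes it valid for all \<open>s \<ge> 1\<close>, since \<open>\<phi>(s) \<le> \<phi>(T s) \<le> T \<phi>(s)\<close>.\<close>

lemma bernstein_dyadic_growth:
  assumes bern: "bernstein \<phi> a b \<mu>" and sv: "slowly_varying l" and pos: "\<And>t. t > 0 \<Longrightarrow> l t > 0"
    and comp: "comparable_on {1..} \<phi> (\<lambda>s. s powr \<rho> * l s)" and p: "p > 1"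
  obtains C where "C \<ge> 1"
    "\<And>s k. s \<ge> 1 \<Longrightarrow> \<phi> (2 ^ k * s) \<le> C * (2 powr \<rho> * p) ^ k * \<phi> s"
    "\<And>s k. s \<ge> 1 \<Longrightarrow> (2 powr \<rho> / p) ^ k * \<phi> s \<le> C * \<phi> (2 ^ k * s)"
proof -
  define g where "g = (\<lambda>s. s powr \<rho> * l s)"
  obtain c where c: "c > 1" "\<And>s. s \<ge> 1 \<Longrightarrow> \<phi> s \<le> c * g s" "\<And>s. s \<ge> 1 \<Longrightarrow> g s \<le> c * \<phi> s"
      "\<And>s. s \<ge> 1 \<Longrightarrow> \<phi> s > 0"
    using comparable_onE[OF comp] pos by (auto simp: g_def)
  obtain T where T: "T \<ge> 1"
    "\<And>t k. t \<ge> T \<Longrightarrow> l (2 ^ k * t) \<le> p ^ k * l t"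
    "\<And>t k. t \<ge> T \<Longrightarrow> l t \<le> p ^ k * l (2 ^ k * t)"
    using slowly_varying_dyadic[OF sv pos p] by metis
  have g: "g (2 ^ k * t) \<le> (2 powr \<rho> * p) ^ k * g t" "(2 powr \<rho> / p) ^ k * g t \<le> g (2 ^ k * t)"
    if "t \<ge> T" for t k
  proof -
    have eq: "(2 ^ k * t) powr \<rho> = (2 powr \<rho>) ^ k * t powr \<rho>"
      using that T(1) by (simp add: powr_mult powr_realpow[symmetric] powr_powr mult.commute)
    show "g (2 ^ k * t) \<le> (2 powr \<rho> * p) ^ k * g t"
      using mult_left_mono[OF T(2)[OF that, of k], of "(2 powr \<rho>) ^ k * t powr \<rho>"]
      unfolding g_def eq by (simp add: power_mult_distrib ac_simps)
    show "(2 powr \<rho> / p) ^ k * g t \<le> g (2 ^ k * t)"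
      using mult_left_mono[OF T(3)[OF that, of k], of "(2 powr \<rho>) ^ k * t powr \<rho>"] p
      unfolding g_def eq by (simp add: power_divide field_simps)
  qed
  have "\<phi> (2 ^ k * s) \<le> c * c * T * (2 powr \<rho> * p) ^ k * \<phi> s \<and>
      (2 powr \<rho> / p) ^ k * \<phi> s \<le> c * c * T * \<phi> (2 ^ k * s)" if s: "s \<ge> 1" for s k
  proof -
    have Ts: "1 \<le> T * s" "T \<le> T * s" "s \<le> T * s"
      using mult_mono[OF T(1) s] mult_left_mono[OF s, of T] mult_right_mono[OF T(1), of s] T(1) s by auto
    have kTs: "1 \<le> 2 ^ k * (T * s)" using mult_mono[of 1 "2 ^ k" 1 "T * s"] Ts by simp
    have shrink: "\<phi> (T * t) \<le> T * \<phi> t" if "t > 0" for t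
      using bernstein_scale[OF bern, of "1 / T" "T * t"] T(1) that by (simp add: field_simps)
    have "\<phi> (2 ^ k * s) \<le> \<phi> (2 ^ k * (T * s))"
      using s Ts by (intro bernstein_mono[OF bern]) auto
    also have "\<dots> \<le> c * g (2 ^ k * (T * s))" by (rule c(2)[OF kTs])
    also have "\<dots> \<le> c * ((2 powr \<rho> * p) ^ k * g (T * s))"
      using g(1)[OF Ts(2)] c(1) by (intro mult_left_mono) auto
    also have "\<dots> \<le> c * ((2 powr \<rho> * p) ^ k * (c * (T * \<phi> s)))"
    proof -
      have "g (T * s) \<le> c * \<phi> (T * s)" using c(3) Ts by simp
      also have "\<dots> \<le> c * (T * \<phi> s)" using shrink[of s] s c(1) by (intro mult_left_mono) auto
      finally show ?thesis using c(1) p by (intro mult_left_mono) auto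
    qed
    finally have 1: "\<phi> (2 ^ k * s) \<le> c * c * T * (2 powr \<rho> * p) ^ k * \<phi> s" by (simp add: ac_simps)
    have "(2 powr \<rho> / p) ^ k * \<phi> s \<le> (2 powr \<rho> / p) ^ k * (c * g (T * s))"
      using bernstein_mono[OF bern, of s "T * s"] c(2)[OF Ts(1)] s Ts p by (intro mult_left_mono) auto
    also have "\<dots> \<le> c * g (2 ^ k * (T * s))"
      using g(2)[OF Ts(2), of k] c(1) by (simp add: ac_simps)
    also have "\<dots> \<le> c * (c * \<phi> (T * (2 ^ k * s)))"
      using c(3)[OF kTs] c(1) by (simp add: ac_simps)
    also have "\<dots> \<le> c * (c * (T * \<phi> (2 ^ k * s)))"
      using shrink[of "2 ^ k * s"] c(1) s by (intro mult_left_mono) auto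
    finally have 2: "(2 powr \<rho> / p) ^ k * \<phi> s \<le> c * c * T * \<phi> (2 ^ k * s)" by (simp add: ac_simps)
    from 1 2 show ?thesis ..
  qed
  moreover have "1 \<le> c * c * T" using mult_mono[OF mult_mono[of 1 c 1 c] T(1)] c(1) by simp
  ultimately show thesis using that by blast
qed

text \<open>Passage from dyadic to arbitrary ratios \<open>t / s\<close> by monotonicity; taking \<open>p\<close> to be \<open>2\<close> to the
power \<open>\<beta> - \<rho>\<close> absorbs the factor \<open>p^k\<close> into the exponent.\<close>

lemma bernstein_power_growth:
  assumes bern: "bernstein \<phi> a b \<mu>" and sv: "slowly_varying l" and pos: "\<And>t. t > 0 \<Longrightarrow> l t > 0"
    and comp: "comparable_on {1..} \<phi> (\<lambda>s. s powr \<rho> * l s)" and \<beta>: "\<rho> < \<beta>" "0 < \<beta>"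
  obtains C where "C > 0" "\<And>s t. 1 \<le> s \<Longrightarrow> s \<le> t \<Longrightarrow> \<phi> t \<le> C * (t / s) powr \<beta> * \<phi> s"
proof -
  have "2 powr (\<beta> - \<rho>) > 1" using \<beta> by simp
  then obtain C where C: "C \<ge> 1"
    "\<And>s k. s \<ge> 1 \<Longrightarrow> \<phi> (2 ^ k * s) \<le> C * (2 powr \<rho> * 2 powr (\<beta> - \<rho>)) ^ k * \<phi> s"
    using bernstein_dyadic_growth[OF bern sv pos comp] by metis
  have "\<phi> t \<le> C * 2 powr \<beta> * (t / s) powr \<beta> * \<phi> s" if st: "1 \<le> s" "s \<le> t" for s t
  proof -
    obtain k :: nat where k: "t / s \<le> 2 ^ k" "2 ^ k \<le> 2 * (t / s)"
      using dyadic_bracket[of "t / s"] st by auto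
    obtain c where c: "\<And>s. s \<ge> 1 \<Longrightarrow> \<phi> s > 0"
      using comparable_onE[OF comp] pos by auto
    have "\<phi> t \<le> \<phi> (2 ^ k * s)"
      using k st by (intro bernstein_mono[OF bern]) (auto simp: field_simps)
    also have "\<dots> \<le> C * (2 powr \<beta>) ^ k * \<phi> s"
      using C(2)[OF st(1), of k] by (simp add: powr_add[symmetric])
    also have "(2 powr \<beta>) ^ k = (2 ^ k) powr \<beta>"
      by (simp add: powr_realpow[symmetric] powr_powr mult.commute)
    also have "C * (2 ^ k) powr \<beta> * \<phi> s \<le> C * (2 * (t / s)) powr \<beta> * \<phi> s"
      using k(2) \<beta> C(1) c[OF st(1)] by (intro mult_right_mono mult_left_mono powr_mono2) auto
    also have "(2 * (t / s)) powr \<beta> = 2 powr \<beta> * (t / s) powr \<beta>"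
      by (rule powr_mult)
    finally show ?thesis by (simp add: mult.assoc)
  qed
  then show thesis using that[of "C * 2 powr \<beta>"] C(1) by simp
qed

text \<open>Since \<open>\<rho> > 0\<close>, \<open>\<phi>\<close> exceeds any prescribed multiple of itself after finitely many doublings of the
argument, uniformly in \<open>s \<ge> 1\<close>. The choice \<open>p = 2^(\<rho>/2)\<close> still leaves the growth rate \<open>2^(\<rho>/2)\<close> per
doubling.\<close>

lemma bernstein_dyadic_multiple:
  assumes bern: "bernstein \<phi> a b \<mu>" and sv: "slowly_varying l" and pos: "\<And>t. t > 0 \<Longrightarrow> l t > 0"
    and comp: "comparable_on {1..} \<phi> (\<lambda>s. s powr \<rho> * l s)" and \<rho>: "0 < \<rho>"
  obtains m :: nat where "\<And>s. s \<ge> 1 \<Longrightarrow> N * \<phi> s \<le> \<phi> (2 ^ m * s)"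
proof -
  have "2 powr (\<rho> / 2) > 1" using \<rho> by simp
  then obtain C where C: "C \<ge> 1"
    "\<And>s k. s \<ge> 1 \<Longrightarrow> (2 powr \<rho> / 2 powr (\<rho> / 2)) ^ k * \<phi> s \<le> C * \<phi> (2 ^ k * s)"
    using bernstein_dyadic_growth[OF bern sv pos comp] by metis
  have eq: "2 powr \<rho> / 2 powr (\<rho> / 2) = 2 powr (\<rho> / 2)" by (simp add: powr_diff[symmetric])
  obtain m where m: "N * C < (2 powr (\<rho> / 2)) ^ m"
    using real_arch_pow[of "2 powr (\<rho> / 2)"] \<rho> by auto
  have "N * \<phi> s \<le> \<phi> (2 ^ m * s)" if "s \<ge> 1" for s
  proof -
    have "\<phi> s > 0" using comparable_onE[OF comp] pos that by auto
    then have "N * C * \<phi> s \<le> (2 powr (\<rho> / 2)) ^ m * \<phi> s" using m by (intro mult_right_mono) auto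
    also have "\<dots> \<le> C * \<phi> (2 ^ m * s)" using C(2)[OF that, of m] unfolding eq .
    finally show ?thesis using C(1) by (simp add: mult.commute mult.left_commute)
  qed
  then show thesis by (rule that)
qed

text \<open>Extends the power bound to small \<open>s\<close> by going through \<open>1\<close>: the bound at infinity compares \<open>\<phi>(t)\<close>
with \<open>\<phi>(1)\<close>, and the lower bound at \<open>0\<close> compares \<open>\<phi>(1)\<close> with \<open>\<phi>(s)\<close>.\<close>

lemma bernstein_growth_from_zero:
  assumes bern: "bernstein \<phi> a b \<mu>" and pos: "\<phi> 1 > 0"
    and upper: "\<And>s t. 1 \<le> s \<Longrightarrow> s \<le> t \<Longrightarrow> \<phi> t \<le> C * (t / s) powr \<beta> * \<phi> s"
    and C: "C > 0"
    and c: "c > 0" and lower: "\<And>s. 0 < s \<Longrightarrow> s \<le> 1 \<Longrightarrow> c * s powr \<gamma> \<le> \<phi> s" and \<gamma>: "\<gamma> \<le> \<beta>"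
  obtains K where "K > 0" "\<And>s t. 1 \<le> t \<Longrightarrow> 0 < s \<Longrightarrow> s \<le> t \<Longrightarrow> \<phi> t \<le> K * (t / s) powr \<beta> * \<phi> s"
proof -
  define K where "K = max C (C * \<phi> 1 / c)"
  have "\<phi> t \<le> K * (t / s) powr \<beta> * \<phi> s" if st: "1 \<le> t" "0 < s" "s \<le> t" for s t
  proof (cases "s \<ge> 1")
    case True
    have "\<phi> t \<le> C * ((t / s) powr \<beta> * \<phi> s)" using upper[OF True st(3)] by (simp add: mult.assoc)
    also have "\<dots> \<le> K * ((t / s) powr \<beta> * \<phi> s)"
      using bernstein_pos[OF bern pos st(2)] by (intro mult_right_mono) (auto simp: K_def)
    finally show ?thesis by (simp add: mult.assoc)
  next
    case False
    have "c * s powr \<beta> \<le> c * s powr \<gamma>"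
      using False st c \<gamma> by (intro mult_left_mono powr_mono') auto
    also have "\<dots> \<le> \<phi> s" using lower[of s] False st by simp
    finally have 1: "1 \<le> \<phi> s / (c * s powr \<beta>)" using c st by (simp add: field_simps)
    have "\<phi> t \<le> C * t powr \<beta> * \<phi> 1 * 1" using upper[of 1 t] st by simp
    also have "\<dots> \<le> C * t powr \<beta> * \<phi> 1 * (\<phi> s / (c * s powr \<beta>))"
      using 1 C pos by (intro mult_left_mono) auto
    also have "\<dots> = (C * \<phi> 1 / c) * ((t / s) powr \<beta> * \<phi> s)"
      using st by (simp add: powr_divide field_simps)
    also have "\<dots> \<le> K * ((t / s) powr \<beta> * \<phi> s)"
      using bernstein_pos[OF bern pos st(2)] by (intro mult_right_mono) (auto simp: K_def)
    finally show ?thesis by (simp add: mult.assoc)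
  qed
  then show thesis using that[of K] C by (auto simp: K_def)
qed

text \<open>The lower limit gives the bound on some interval \<open>(0, \<delta>)\<close>; on \<open>[\<delta>, 1]\<close> monotonicity suffices.\<close>

lemma bernstein_power_bound_at_zero:
  assumes bern: "bernstein \<phi> a b \<mu>" and pos: "\<phi> 1 > 0" and "0 \<le> \<gamma>"
    and "Liminf (at_right 0) (\<lambda>s. ereal (\<phi> s / s powr \<gamma>)) > 0"
  obtains c where "c > 0" "\<And>s. 0 < s \<Longrightarrow> s \<le> 1 \<Longrightarrow> c * s powr \<gamma> \<le> \<phi> s"
proof -
  obtain e where e: "0 < e" "ereal e < Liminf (at_right 0) (\<lambda>s. ereal (\<phi> s / s powr \<gamma>))"
    using ereal_dense2[OF assms(4)] by (auto simp flip: zero_ereal_def)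
  have "\<forall>\<^sub>F s in at_right 0. ereal e < ereal (\<phi> s / s powr \<gamma>)" by (rule less_LiminfD[OF e(2)])
  then obtain \<delta> where \<delta>: "\<delta> > 0" "\<And>s. 0 < s \<Longrightarrow> s < \<delta> \<Longrightarrow> e < \<phi> s / s powr \<gamma>"
    by (auto simp: eventually_at_right[of 0 1])
  have "min e (\<phi> \<delta>) * s powr \<gamma> \<le> \<phi> s" if "0 < s" "s \<le> 1" for s
  proof (cases "s < \<delta>")
    case True
    have "min e (\<phi> \<delta>) * s powr \<gamma> \<le> e * s powr \<gamma>" by (intro mult_right_mono) auto
    also have "\<dots> \<le> \<phi> s" using \<delta>(2)[OF that(1) True] that by (simp add: field_simps)
    finally show ?thesis .
  next
    case False
    have "min e (\<phi> \<delta>) * s powr \<gamma> \<le> \<phi> \<delta> * 1"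
      using that assms(3) bernstein_pos[OF bern pos \<delta>(1)]
      by (intro mult_mono) (auto intro: powr_le1)
    also have "\<dots> \<le> \<phi> s" using bernstein_mono[OF bern \<delta>(1)] False by simp
    finally show ?thesis .
  qed
  then show thesis using that[of "min e (\<phi> \<delta>)"] e(1) bernstein_pos[OF bern pos \<delta>(1)] by simp
qed

section \<open>Bounds on the heat kernel\<close>

lemma heat_kernel_nonneg: "0 \<le> heat_kernel t x"
  by (simp add: heat_kernel_def)

lemma heat_kernel_measurable[measurable]: "(\<lambda>t. heat_kernel t x) \<in> borel_measurable borel"
  unfolding heat_kernel_def by measurable

text \<open>The Gaussian factor beats the singularity of the heat kernel at small times; the variable \<open>u\<close>
stands for \<open>|x|\<^sup>2 / t\<close>. The constant comes from \<open>(1 + y/d)^d \<le> exp y\<close> at \<open>y = u/4\<close>.\<close>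

lemma powr_exp_bound:
  fixes u :: real
  assumes "u \<ge> 1" and d: "d > 0"
  shows "u powr (real d / 2) * exp (- u / 4) \<le> real (4 * d) ^ d"
proof -
  have "u powr (real d / 2) \<le> u powr real d" using assms by (intro powr_mono) auto
  also have "\<dots> = real (4 * d) ^ d * (u / 4 / real d) ^ d"
  proof -
    have "u powr real d = u ^ d" using assms by (intro powr_realpow) auto
    also have "u ^ d = (real (4 * d) * (u / 4 / real d)) ^ d"
      by (rule arg_cong[where f = "\<lambda>z. z ^ d"]) (use d in simp)
    also have "\<dots> = real (4 * d) ^ d * (u / 4 / real d) ^ d" by (rule power_mult_distrib)
    finally show ?thesis .
  qed
  also have "\<dots> \<le> real (4 * d) ^ d * (1 + u / 4 / real d) ^ d"
    using assms by (intro mult_left_mono power_mono) auto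
  also have "\<dots> \<le> real (4 * d) ^ d * exp (u / 4)"
    using exp_ge_one_plus_x_over_n_power_n[of d "u / 4"] assms d by (intro mult_left_mono) auto
  finally have "u powr (real d / 2) \<le> real (4 * d) ^ d * exp (u / 4)" .
  then have "u powr (real d / 2) * exp (- u / 4) \<le> real (4 * d) ^ d * exp (u / 4) * exp (- u / 4)"
    by (intro mult_right_mono) auto
  also have "\<dots> = real (4 * d) ^ d" by (simp add: exp_minus)
  finally show ?thesis .
qed

lemma power2_powr_minus_half:
  fixes r :: real
  assumes "r > 0"
  shows "(r\<^sup>2) powr (- real n / 2) = 1 / r ^ n"
proof -
  have "(r\<^sup>2) powr (- real n / 2) = (r powr 2) powr (- real n / 2)" using assms by simp
  also have "\<dots> = r powr (- real n)" unfolding powr_powr by simp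
  also have "\<dots> = 1 / r ^ n" using assms by (simp add: powr_minus_divide powr_realpow)
  finally show ?thesis .
qed

lemma power_powr_swap: "((2::real) ^ k) powr e = (2 powr e) ^ k"
  by (simp add: powr_realpow[symmetric] powr_powr mult.commute)

text \<open>The heat kernel in units of the natural time scale \<open>|x|\<^sup>2\<close>.\<close>

lemma heat_kernel_le:
  fixes x :: "'a::euclidean_space"
  assumes "x \<noteq> 0" "v > 0"
  shows "heat_kernel (v * (norm x)\<^sup>2) x
      \<le> 1 / norm x ^ DIM('a) * (v powr (- real DIM('a) / 2) * exp (- (1 / v) / 4))"
proof -
  let ?d = "real DIM('a)"
  have r: "norm x > 0" using assms by simp
  have rd: "((norm x)\<^sup>2) powr (- ?d / 2) = 1 / norm x ^ DIM('a)"
    using r by (rule power2_powr_minus_half)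
  have "(4 * pi * (v * (norm x)\<^sup>2)) powr (- ?d / 2) \<le> (v * (norm x)\<^sup>2) powr (- ?d / 2)"
    using assms r pi_gt3 by (intro powr_mono2') (auto simp: zero_less_mult_iff)
  also have "\<dots> = v powr (- ?d / 2) * (1 / norm x ^ DIM('a))"
    unfolding powr_mult rd ..
  finally have 1: "(4 * pi * (v * (norm x)\<^sup>2)) powr (- ?d / 2) \<le> v powr (- ?d / 2) * (1 / norm x ^ DIM('a))" .
  have 2: "- (norm x)\<^sup>2 / (4 * (v * (norm x)\<^sup>2)) = - (1 / v) / 4" using assms by (simp add: field_simps)
  show ?thesis
    unfolding heat_kernel_def 2 using mult_right_mono[OF 1, of "exp (- (1 / v) / 4)"]
    by (simp only: ac_simps exp_ge_zero)
qed

text \<open>Every time \<open>t\<close> has a dyadic layer \<open>k\<close> whose exponential dominates the heat kernel at \<open>t\<close>: for \<open>t \<le> |x|\<^sup>2\<close>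
it is \<open>k = 0\<close>, and otherwise \<open>2^k\<close> is a power of two between \<open>v\<close> and \<open>2 v\<close> for \<open>v = t / |x|\<^sup>2\<close>, so that the exponential is at
least \<open>1 / e\<close>. Summing over all \<open>k\<close> therefore gives a majorant of the heat kernel by exponentials.\<close>

lemma heat_kernel_dyadic_upper:
  obtains C where "C > 0"
    "\<And>(x :: 'a::euclidean_space) t. x \<noteq> 0 \<Longrightarrow> t > 0 \<Longrightarrow>
      \<exists>k. heat_kernel t x \<le>
        C / norm x ^ DIM('a) * (2 powr (- real DIM('a) / 2)) ^ k * exp (- (1 / (norm x)\<^sup>2 / 2 ^ k) * t)"
proof -
  let ?d = "real DIM('a)"
  define D where "D = real (4 * DIM('a)) ^ DIM('a)"
  define C where "C = exp 1 * (D + 2 powr (?d / 2))"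
  have D: "D > 0" by (simp add: D_def)
  have C: "C > 0" "C * exp (- 1) = D + 2 powr (?d / 2)"
    using D by (auto simp: C_def exp_minus intro!: mult_pos_pos add_pos_pos)
  have "\<exists>k. heat_kernel t x \<le> C / norm x ^ DIM('a) * (2 powr (- ?d / 2)) ^ k * exp (- (1 / (norm x)\<^sup>2 / 2 ^ k) * t)"
    if "x \<noteq> 0" "t > 0" for x :: 'a and t
  proof -
    define v where "v = t / (norm x)\<^sup>2"
    have v: "v > 0" "t = v * (norm x)\<^sup>2" using that by (auto simp: v_def)
    have expv: "- (1 / (norm x)\<^sup>2 / 2 ^ k) * t = - (v / 2 ^ k)" for k :: nat
      using that by (simp add: v_def)
    have bd: "\<exists>k. v powr (- ?d / 2) * exp (- (1 / v) / 4) \<le> C * (2 powr (- ?d / 2)) ^ k * exp (- (v / 2 ^ k))"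
    proof (cases "v \<le> 1")
      case True
      have "v powr (- ?d / 2) * exp (- (1 / v) / 4) = (1 / v) powr (?d / 2) * exp (- (1 / v) / 4)"
        using v by (simp add: powr_minus_divide powr_divide)
      also have "\<dots> \<le> D"
        unfolding D_def using True v by (intro powr_exp_bound) auto
      also have "\<dots> \<le> C * exp (- 1)" unfolding C by simp
      also have "\<dots> \<le> C * exp (- v)" using True C(1) by (intro mult_left_mono) auto
      finally show ?thesis by (intro exI[of _ 0]) simp
    next
      case False
      then obtain k :: nat where k: "v \<le> 2 ^ k" "2 ^ k \<le> 2 * v"
        using dyadic_bracket[of v] by auto
      have "v powr (- ?d / 2) * exp (- (1 / v) / 4) \<le> v powr (- ?d / 2) * 1"
        using v by (intro mult_left_mono) auto
      also have "\<dots> \<le> (2 ^ k / 2) powr (- ?d / 2) * 1"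
        using k v by (intro mult_right_mono powr_mono2') auto
      also have "\<dots> = 2 powr (?d / 2) * (2 powr (- ?d / 2)) ^ k"
        unfolding powr_divide power_powr_swap by (simp add: powr_minus_divide)
      also have "\<dots> \<le> (C * exp (- 1)) * (2 powr (- ?d / 2)) ^ k"
        unfolding C using D by (intro mult_right_mono) auto
      also have "\<dots> \<le> (C * exp (- (v / 2 ^ k))) * (2 powr (- ?d / 2)) ^ k"
        using k(1) C(1) by (intro mult_right_mono mult_left_mono) auto
      finally show ?thesis by (intro exI[of _ k]) (simp only: ac_simps)
    qed
    then obtain k where k: "v powr (- ?d / 2) * exp (- (1 / v) / 4) \<le> C * (2 powr (- ?d / 2)) ^ k * exp (- (v / 2 ^ k))"
      by blast
    have "heat_kernel t x \<le> 1 / norm x ^ DIM('a) * (v powr (- ?d / 2) * exp (- (1 / v) / 4))"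
      using heat_kernel_le[OF that(1) v(1)] v(2) by simp
    also have "\<dots> \<le> 1 / norm x ^ DIM('a) * (C * (2 powr (- ?d / 2)) ^ k * exp (- (v / 2 ^ k)))"
      using k by (intro mult_left_mono) auto
    finally show ?thesis unfolding expv by (intro exI[of _ k]) simp
  qed
  then show thesis using that C(1) by blast
qed

lemma heat_kernel_lower:
  assumes "0 < K" "0 < \<delta>"
  obtains c where "c > 0"
    "\<And>(x :: 'a::euclidean_space) t. x \<noteq> 0 \<Longrightarrow> \<delta> * (norm x)\<^sup>2 \<le> t \<Longrightarrow> t \<le> K * (norm x)\<^sup>2 \<Longrightarrow>
       c / norm x ^ DIM('a) \<le> heat_kernel t x"
proof -
  let ?d = "real DIM('a)"
  define c where "c = (4 * pi * K) powr (- ?d / 2) * exp (- 1 / (4 * \<delta>))"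
  have "c / norm x ^ DIM('a) \<le> heat_kernel t x"
    if x: "x \<noteq> 0" and t: "\<delta> * (norm x)\<^sup>2 \<le> t" "t \<le> K * (norm x)\<^sup>2" for x :: 'a and t
  proof -
    have r: "norm x > 0" using x by simp
    have "0 < \<delta> * (norm x)\<^sup>2" using assms r by simp
    then have "t > 0" using t by linarith
    have rd: "((norm x)\<^sup>2) powr (- ?d / 2) = 1 / norm x ^ DIM('a)"
      using r by (rule power2_powr_minus_half)
    have "c / norm x ^ DIM('a) = (4 * pi * K * (norm x)\<^sup>2) powr (- ?d / 2) * exp (- 1 / (4 * \<delta>))"
      unfolding c_def powr_mult[of "4 * pi * K"] rd by simp
    also have "\<dots> \<le> (4 * pi * t) powr (- ?d / 2) * exp (- (norm x)\<^sup>2 / (4 * t))"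
    proof (rule mult_mono[OF powr_mono2'])
      show "4 * pi * t \<le> 4 * pi * K * (norm x)\<^sup>2"
        using mult_left_mono[OF t(2), of "4 * pi"] by (simp add: mult.assoc)
      show "exp (- 1 / (4 * \<delta>)) \<le> exp (- (norm x)\<^sup>2 / (4 * t))"
        using t assms \<open>t > 0\<close> by (simp add: field_simps)
    qed (use t \<open>t > 0\<close> in auto)
    finally show ?thesis by (simp add: heat_kernel_def)
  qed
  moreover have "c > 0" using assms by (simp add: c_def)
  ultimately show thesis using that by blast
qed

section \<open>Integrating the heat kernel by means of a Laplace transform\<close>

text \<open>Integration of the dyadic majorant. The growth bound turns \<open>1 / \<phi>(2^(-k) s)\<close> into
\<open>K 2^(k \<beta>) / \<phi>(s)\<close>, and the condition \<open>\<beta> < d/2\<close> is exactly the convergence of the resulting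
geometric series with ratio \<open>q\<close>.\<close>

lemma heat_kernel_integral_upper:
  fixes U :: "real measure"
  assumes [measurable_cong]: "sets U = sets borel"
    and lap: "\<And>s. s > 0 \<Longrightarrow> (\<integral>\<^sup>+t. ennreal (exp (- s * t)) \<partial>U) = ennreal (1 / \<phi> s)"
    and pos: "\<And>s. s > 0 \<Longrightarrow> \<phi> s > 0"
    and growth: "\<And>s t. 1 \<le> t \<Longrightarrow> 0 < s \<Longrightarrow> s \<le> t \<Longrightarrow> \<phi> t \<le> K * (t / s) powr \<beta> * \<phi> s"
    and K: "K > 0" and \<beta>: "\<beta> < real DIM('a) / 2"
  obtains C where "C > 0"
    "\<And>x :: 'a::euclidean_space. 0 < norm x \<Longrightarrow> norm x \<le> 1 \<Longrightarrow>
      (\<integral>\<^sup>+t. ennreal (indicator {0<..} t * heat_kernel t x) \<partial>U)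
        \<le> ennreal (C * (1 / (norm x ^ DIM('a) * \<phi> (1 / norm x ^ 2))))"
proof -
  let ?d = "real DIM('a)"
  obtain C0 where C0: "C0 > 0"
    "\<And>(x :: 'a) t. x \<noteq> 0 \<Longrightarrow> t > 0 \<Longrightarrow>
      \<exists>k. heat_kernel t x \<le>
        C0 / norm x ^ DIM('a) * (2 powr (- ?d / 2)) ^ k * exp (- (1 / (norm x)\<^sup>2 / 2 ^ k) * t)"
    using heat_kernel_dyadic_upper by metis
  define q where "q = 2 powr (\<beta> - ?d / 2)"
  have q: "0 < q" "q < 1" using \<beta> by (auto simp: q_def powr_less_one)
  have "(\<integral>\<^sup>+t. ennreal (indicator {0<..} t * heat_kernel t x) \<partial>U)
        \<le> ennreal (C0 * K / (1 - q) * (1 / (norm x ^ DIM('a) * \<phi> (1 / norm x ^ 2))))"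
    if x: "0 < norm x" "norm x \<le> 1" for x :: 'a
  proof -
    define s where "s = 1 / (norm x)\<^sup>2"
    have s: "s \<ge> 1" using x by (simp add: s_def power_le_one)
    define A where "A = C0 / norm x ^ DIM('a)"
    have A: "A > 0" using C0 x by (simp add: A_def)
    define w where "w = (\<lambda>k. A * (2 powr (- ?d / 2)) ^ k)"
    have w: "w k \<ge> 0" for k using A by (simp add: w_def)
    have "(\<integral>\<^sup>+t. ennreal (indicator {0<..} t * heat_kernel t x) \<partial>U)
        \<le> (\<integral>\<^sup>+t. (\<Sum>k. ennreal (w k * exp (- (s / 2 ^ k) * t))) \<partial>U)"
    proof (rule nn_integral_mono)
      fix t :: real
      show "ennreal (indicator {0<..} t * heat_kernel t x) \<le> (\<Sum>k. ennreal (w k * exp (- (s / 2 ^ k) * t)))"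
      proof (cases "t > 0")
        case True
        then obtain k where "heat_kernel t x \<le> w k * exp (- (s / 2 ^ k) * t)"
          using C0(2)[of x t] x by (auto simp: w_def A_def s_def)
        then have "ennreal (indicator {0<..} t * heat_kernel t x) \<le> ennreal (w k * exp (- (s / 2 ^ k) * t))"
          using True by (simp add: ennreal_leI)
        also have "\<dots> \<le> (\<Sum>k. ennreal (w k * exp (- (s / 2 ^ k) * t)))"
          using sum_le_suminf[of "\<lambda>k. ennreal (w k * exp (- (s / 2 ^ k) * t))" "{k}"] by simp
        finally show ?thesis .
      qed simp
    qed
    also have "\<dots> = (\<Sum>k. \<integral>\<^sup>+t. ennreal (w k * exp (- (s / 2 ^ k) * t)) \<partial>U)"
      by (rule nn_integral_suminf) measurable
    also have "\<dots> \<le> (\<Sum>k. ennreal (A * K / \<phi> s * q ^ k))"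
    proof (rule suminf_le)
      fix k
      have sk: "0 < s / 2 ^ k" "s / 2 ^ k \<le> s" using s by (auto simp: field_simps)
      have "(\<integral>\<^sup>+t. ennreal (w k * exp (- (s / 2 ^ k) * t)) \<partial>U) =
          ennreal (w k) * (\<integral>\<^sup>+t. ennreal (exp (- (s / 2 ^ k) * t)) \<partial>U)"
        using w by (subst nn_integral_cmult[symmetric]) (auto simp: ennreal_mult)
      also have "\<dots> = ennreal (w k / \<phi> (s / 2 ^ k))"
        using lap[OF sk(1)] pos[OF sk(1)] w by (simp add: ennreal_mult[symmetric])
      also have "w k / \<phi> (s / 2 ^ k) \<le> w k * (K * (2 ^ k) powr \<beta> / \<phi> s)"
      proof -
        have "\<phi> s \<le> K * (2 ^ k) powr \<beta> * \<phi> (s / 2 ^ k)"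
          using growth[OF s sk] s by simp
        then have "1 / \<phi> (s / 2 ^ k) \<le> K * (2 ^ k) powr \<beta> / \<phi> s"
          using pos[OF sk(1)] pos[of s] s by (simp add: field_simps)
        from mult_left_mono[OF this w[of k]] show ?thesis by simp
      qed
      also have "w k * (K * (2 ^ k) powr \<beta> / \<phi> s) = A * K / \<phi> s * q ^ k"
      proof -
        have "q ^ k = (2 powr (- ?d / 2)) ^ k * (2 ^ k) powr \<beta>"
          unfolding q_def power_powr_swap power_mult_distrib[symmetric] powr_add[symmetric]
          by (simp add: add.commute)
        then show ?thesis by (simp add: w_def)
      qed
      finally show "(\<integral>\<^sup>+t. ennreal (w k * exp (- (s / 2 ^ k) * t)) \<partial>U) \<le> ennreal (A * K / \<phi> s * q ^ k)"
        by (simp add: ennreal_leI)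
    qed auto
    also have "\<dots> = ennreal (A * K / \<phi> s * (1 / (1 - q)))"
      using A K pos[of s] s q
      by (intro suminf_ennreal_eq sums_mult geometric_sums) auto
    also have "A * K / \<phi> s * (1 / (1 - q)) = C0 * K / (1 - q) * (1 / (norm x ^ DIM('a) * \<phi> (1 / norm x ^ 2)))"
      by (simp add: A_def s_def)
    finally show ?thesis .
  qed
  moreover have "C0 * K / (1 - q) > 0" using C0 K q by simp
  ultimately show thesis using that by blast
qed

text \<open>The three terms of the pointwise bound in the proof take care of small, middle and large times,
respectively. The first and third integrate to at most \<open>1 / (4 \<phi>(s))\<close> each, by the growth hypothesis and by
concavity, hence the middle one carries at least half of \<open>1 / \<phi>(s)\<close>.\<close>

lemma heat_kernel_integral_lower:
  fixes U :: "real measure"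
  assumes [measurable_cong]: "sets U = sets borel"
    and nonneg: "AE t in U. 0 \<le> t"
    and lap: "\<And>s. s > 0 \<Longrightarrow> (\<integral>\<^sup>+t. ennreal (exp (- s * t)) \<partial>U) = ennreal (1 / \<phi> s)"
    and pos: "\<And>s. s > 0 \<Longrightarrow> \<phi> s > 0"
    and half: "\<And>s. s > 0 \<Longrightarrow> \<phi> s \<le> 2 * \<phi> (s / 2)"
    and growth: "\<And>s. s \<ge> 1 \<Longrightarrow> 4 * exp 1 * \<phi> s \<le> \<phi> (2 ^ m * s)"
  obtains C where "C > 0"
    "\<And>x :: 'a::euclidean_space. 0 < norm x \<Longrightarrow> norm x \<le> 1 \<Longrightarrow>
      ennreal (1 / (norm x ^ DIM('a) * \<phi> (1 / norm x ^ 2))) \<le>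
      ennreal C * (\<integral>\<^sup>+t. ennreal (indicator {0<..} t * heat_kernel t x) \<partial>U)"
proof -
  \<comment> \<open>Beyond \<open>K / s\<close> half of the exponent is spent on the factor \<open>exp (- K / 2) = 1/8\<close>; the other half
    remains as \<open>exp (- s t / 2)\<close>, whose integral \<open>1 / \<phi>(s/2)\<close> is at most \<open>2 / \<phi>(s)\<close>.\<close>
  define K :: real where "K = 2 * ln 8"
  have K: "K > 0" "exp (- K / 2) = 1 / 8" by (auto simp: K_def exp_minus)
  obtain c where c: "c > 0"
    "\<And>(x :: 'a) t. x \<noteq> 0 \<Longrightarrow> 1 / 2 ^ m * (norm x)\<^sup>2 \<le> t \<Longrightarrow> t \<le> K * (norm x)\<^sup>2 \<Longrightarrow>
       c / norm x ^ DIM('a) \<le> heat_kernel t x"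
    using heat_kernel_lower[of K "1 / 2 ^ m"] K by (metis zero_less_divide_1_iff zero_less_power zero_less_numeral)
  have "ennreal (1 / (norm x ^ DIM('a) * \<phi> (1 / norm x ^ 2))) \<le>
      ennreal (2 / c) * (\<integral>\<^sup>+t. ennreal (indicator {0<..} t * heat_kernel t x) \<partial>U)"
    if x: "0 < norm x" "norm x \<le> 1" for x :: 'a
  proof -
    define r where "r = norm x ^ DIM('a)"
    have r: "r > 0" using x by (simp add: r_def)
    define s where "s = 1 / (norm x)\<^sup>2"
    have s: "s \<ge> 1" using x by (simp add: s_def power_le_one)
    define I where "I = (\<integral>\<^sup>+t. ennreal (indicator {0<..} t * heat_kernel t x) \<partial>U)"
    have point: "exp (- s * t) \<le> exp 1 * exp (- (2 ^ m * s) * t) +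
        (r / c * (indicator {0<..} t * heat_kernel t x) + 1 / 8 * exp (- (s / 2) * t))" if "t \<ge> 0" for t
    proof -
      have n: "0 \<le> r / c * (indicator {0<..} t * heat_kernel t x)"
        using r c(1) by (auto simp: heat_kernel_nonneg)
      consider "2 ^ m * s * t \<le> 1" | "2 ^ m * s * t > 1" "s * t \<le> K" | "s * t > K" by linarith
      then show ?thesis
      proof cases
        case 1
        \<comment> \<open>Small times: \<open>exp (1 - 2^m s t) \<ge> 1\<close>.\<close>
        have "0 \<le> s * t" using that s by simp
        then have "exp (- s * t) \<le> exp (1 + - (2 ^ m * s) * t)" using 1 by simp
        also have "\<dots> = exp 1 * exp (- (2 ^ m * s) * t)" by (rule exp_add)
        finally show ?thesis using n exp_ge_zero[of "- (s / 2) * t"] by linarith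
      next
        case 2
        have "t > 0" using 2 that by (cases "t = 0") auto
        have "1 / 2 ^ m * (norm x)\<^sup>2 \<le> t" "t \<le> K * (norm x)\<^sup>2"
          using 2 x by (auto simp: s_def field_simps)
        then have "c / r \<le> heat_kernel t x" using c(2)[of x t] x by (auto simp: r_def)
        then have "1 \<le> r / c * (indicator {0<..} t * heat_kernel t x)"
          using c(1) r \<open>t > 0\<close> by (simp add: field_simps)
        moreover have "exp (- s * t) \<le> 1" using s that by simp
        ultimately show ?thesis using exp_ge_zero[of "- (s / 2) * t"]
            mult_nonneg_nonneg[OF exp_ge_zero exp_ge_zero, of 1 "- (2 ^ m * s) * t"] by linarith
      next
        case 3
        have "exp (- s * t) \<le> exp (- K / 2 + - (s / 2) * t)" using 3 by simp
        also have "\<dots> = 1 / 8 * exp (- (s / 2) * t)" unfolding exp_add K(2) ..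
        finally show ?thesis using n mult_nonneg_nonneg[OF exp_ge_zero exp_ge_zero, of 1 "- (2 ^ m * s) * t"]
          by linarith
      qed
    qed
    have "ennreal (1 / \<phi> s) = (\<integral>\<^sup>+t. ennreal (exp (- s * t)) \<partial>U)" using lap[of s] s by simp
    also have "\<dots> \<le> (\<integral>\<^sup>+t. ennreal (exp 1) * ennreal (exp (- (2 ^ m * s) * t)) +
        (ennreal (r / c) * ennreal (indicator {0<..} t * heat_kernel t x) +
         ennreal (1 / 8) * ennreal (exp (- (s / 2) * t))) \<partial>U)"
    proof (rule nn_integral_mono_AE, rule eventually_mono[OF nonneg], goal_cases)
      case (1 t)
      show ?case using point[OF 1] r c(1)
        by (simp add: ennreal_mult[symmetric] ennreal_plus[symmetric] heat_kernel_nonneg ennreal_leI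
            del: ennreal_plus)
    qed
    also have "\<dots> = ennreal (exp 1) * (\<integral>\<^sup>+t. ennreal (exp (- (2 ^ m * s) * t)) \<partial>U) +
        (ennreal (r / c) * I + ennreal (1 / 8) * (\<integral>\<^sup>+t. ennreal (exp (- (s / 2) * t)) \<partial>U))"
      unfolding I_def by (simp add: nn_integral_add nn_integral_cmult)
    also have "\<dots> = ennreal (exp 1 / \<phi> (2 ^ m * s)) + (ennreal (r / c) * I + ennreal (1 / 8 / \<phi> (s / 2)))"
      using lap[of "2 ^ m * s"] lap[of "s / 2"] pos[of "2 ^ m * s"] pos[of "s / 2"] s
      by (simp add: ennreal_mult[symmetric])
    also have "\<dots> \<le> ennreal (1 / \<phi> s / 4) + (ennreal (r / c) * I + ennreal (1 / \<phi> s / 4))"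
    proof (intro add_mono ennreal_leI order_refl)
      show "exp 1 / \<phi> (2 ^ m * s) \<le> 1 / \<phi> s / 4"
        using growth[OF s] pos[of "2 ^ m * s"] pos[of s] s by (simp add: field_simps)
      show "1 / 8 / \<phi> (s / 2) \<le> 1 / \<phi> s / 4"
        using half[of s] pos[of "s / 2"] pos[of s] s by (simp add: field_simps)
    qed
    finally have main: "ennreal (1 / \<phi> s) \<le>
        ennreal (1 / \<phi> s / 4) + (ennreal (r / c) * I + ennreal (1 / \<phi> s / 4))" .
    \<comment> \<open>The terms \<open>1 / (4 \<phi>(s))\<close> are cancelled in the reals, so the trivial case of an infinite integral is
      separated first.\<close>
    show ?thesis
    proof (cases "I = \<infinity>")
      case True
      then show ?thesis using c(1) unfolding I_def by (simp add: ennreal_mult_top)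
    next
      case False
      then obtain J where J: "I = ennreal J" "J \<ge> 0" by (cases I) auto
      have ps: "\<phi> s > 0" using pos s by simp
      from main have "1 / \<phi> s \<le> 1 / \<phi> s / 4 + (r / c * J + 1 / \<phi> s / 4)"
        unfolding J(1) using J(2) ps r c(1)
        by (simp add: ennreal_mult[symmetric] ennreal_plus[symmetric] del: ennreal_plus)
      then have "1 / \<phi> s \<le> 2 * (r / c * J)" by simp
      then have "1 / (r * \<phi> s) \<le> 2 / c * J"
        using r ps by (simp add: field_simps)
      then have "ennreal (1 / (r * \<phi> s)) \<le> ennreal (2 / c) * ennreal J"
        using J(2) c(1) by (simp add: ennreal_mult[symmetric] ennreal_leI)
      then show ?thesis unfolding J(1)[symmetric] I_def r_def s_def .
    qed
  qed
  then show thesis using that[of "2 / c"] c(1) by simp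
qed

section \<open>The Green function\<close>

theorem theorem3p2:
  fixes M :: "'w measure"
    and B X :: "real \<Rightarrow> 'w \<Rightarrow> 'a::euclidean_space"
    and S :: "real \<Rightarrow> 'w \<Rightarrow> real"
    and \<phi> l :: "real \<Rightarrow> real"
    and b \<alpha> :: real
    and \<mu> :: "real measure"
  assumes "subordinate_brownian_motion M B S X"
    and "laplace_exponent M S \<phi>"
    and "complete_bernstein \<phi> 0 b \<mu>"
    and "0 < \<alpha>" and "\<alpha> < min 2 (real DIM('a))"
    and "l \<in> borel_measurable (restrict_space borel {0<..})"
    and "\<forall>t>0. l t > 0"
    and "locally_bounded_above_below l"
    and "slowly_varying l"
    and "comparable_on {1..} \<phi> (\<lambda>s. s powr (\<alpha> / 2) * l s)"
    and "DIM('a) \<le> 2 \<longrightarrow>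
      (\<exists>\<gamma>. 0 \<le> \<gamma> \<and> \<gamma> < real DIM('a) / 2 \<and>
        Liminf (at_right 0) (\<lambda>s. ereal (\<phi> s / s powr \<gamma>)) > 0)"
  shows "comparable_on {x :: 'a. 0 < norm x \<and> norm x \<le> 1}
           (green_function M S)
           (\<lambda>x. 1 / (norm x ^ DIM('a) * \<phi> (1 / norm x ^ 2)))
       \<and> comparable_on {x :: 'a. 0 < norm x \<and> norm x \<le> 1}
           (\<lambda>x. 1 / (norm x ^ DIM('a) * \<phi> (1 / norm x ^ 2)))
           (\<lambda>x. 1 / (norm x powr (real DIM('a) - \<alpha>) * l (1 / norm x ^ 2)))"
proof -
  define G where "G = (green_function M S :: 'a \<Rightarrow> real)"
  define D where "D = {x :: 'a. 0 < norm x \<and> norm x \<le> 1}"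
  define g where "g = (\<lambda>x :: 'a. 1 / (norm x ^ DIM('a) * \<phi> (1 / norm x ^ 2)))"
  define h where "h = (\<lambda>x :: 'a. 1 / (norm x powr (real DIM('a) - \<alpha>) * l (1 / norm x ^ 2)))"
  define U where "U = potential_measure M S"
  have sub: "subordinator M S" using assms(1) by (simp add: subordinate_brownian_motion_def)
  have bern: "bernstein \<phi> 0 b \<mu>" using assms(3) by (simp add: complete_bernstein_def)
  have lpos: "l t > 0" if "t > 0" for t using assms(7) that by blast
  note comp = assms(10) and sv = assms(9)
  obtain c where c: "c > 1" "\<And>s. s \<ge> 1 \<Longrightarrow> \<phi> s \<le> c * (s powr (\<alpha> / 2) * l s)"
      "\<And>s. s \<ge> 1 \<Longrightarrow> s powr (\<alpha> / 2) * l s \<le> c * \<phi> s" "\<And>s. s \<ge> 1 \<Longrightarrow> \<phi> s > 0"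
    using comparable_onE[OF comp] lpos by auto
  have pos1: "\<phi> 1 > 0" using c(4) by simp
  note pos = bernstein_pos[OF bern pos1]
  have sets_U [measurable_cong]: "sets U = sets borel"
    using sub by (simp add: U_def sets_potential_measure subordinator_def)
  have U_nonneg: "AE t in U. 0 \<le> t" unfolding U_def by (rule AE_potential_measure_nonneg[OF sub])
  have lap: "(\<integral>\<^sup>+t. ennreal (exp (- s * t)) \<partial>U) = ennreal (1 / \<phi> s)" if "s > 0" for s
    unfolding U_def using nn_integral_exp_potential_measure[OF sub assms(2) that pos[OF that]] .

  obtain \<gamma> c0 where \<gamma>: "0 \<le> \<gamma>" "\<gamma> < real DIM('a) / 2"
    and c0: "c0 > 0" "\<And>s. 0 < s \<Longrightarrow> s \<le> 1 \<Longrightarrow> c0 * s powr \<gamma> \<le> \<phi> s"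
  proof (cases "DIM('a) \<le> 2")
    case True
    then obtain \<gamma> where g: "0 \<le> \<gamma>" "\<gamma> < real DIM('a) / 2"
        and inf: "Liminf (at_right 0) (\<lambda>s. ereal (\<phi> s / s powr \<gamma>)) > 0"
      using assms(11) by blast
    show ?thesis
      by (rule bernstein_power_bound_at_zero[OF bern pos1 g(1) inf]) (rule that[OF g])
  next
    case False
    \<comment> \<open>For \<open>d \<ge> 3\<close> concavity alone gives \<open>\<gamma> = 1 < d/2\<close>.\<close>
    have "\<phi> 1 * s powr 1 \<le> \<phi> s" if "0 < s" "s \<le> 1" for s
      using bernstein_scale[OF bern that, of 1] that by (simp add: mult.commute)
    then show ?thesis using that[of 1 "\<phi> 1"] pos1 False by simp
  qed
  have "\<alpha> / 2 < real DIM('a) / 2" using assms(5) by simp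
  then obtain \<beta>' where \<beta>': "\<alpha> / 2 < \<beta>'" "\<beta>' < real DIM('a) / 2" by (metis dense)
  \<comment> \<open>The exponent must exceed \<open>\<alpha>/2\<close> for the growth at infinity, be at least \<open>\<gamma>\<close> for the growth
    from \<open>0\<close>, and stay below \<open>d/2\<close> for the dyadic series to converge.\<close>
  define \<beta> where "\<beta> = max \<gamma> \<beta>'"
  have \<beta>: "\<alpha> / 2 < \<beta>" "0 < \<beta>" "\<beta> < real DIM('a) / 2" "\<gamma> \<le> \<beta>"
    using assms(4) \<gamma> \<beta>' unfolding \<beta>_def by linarith+
  obtain K1 where K1: "K1 > 0" "\<And>s t. 1 \<le> s \<Longrightarrow> s \<le> t \<Longrightarrow> \<phi> t \<le> K1 * (t / s) powr \<beta> * \<phi> s"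
    using bernstein_power_growth[OF bern sv lpos comp \<beta>(1,2)] by blast
  obtain K where K: "K > 0"
      "\<And>s t. 1 \<le> t \<Longrightarrow> 0 < s \<Longrightarrow> s \<le> t \<Longrightarrow> \<phi> t \<le> K * (t / s) powr \<beta> * \<phi> s"
    using bernstein_growth_from_zero[OF bern pos1 K1(2,1) c0 \<beta>(4)] by blast
  have "0 < \<alpha> / 2" using assms(4) by simp
  then obtain m :: nat where m: "\<And>s. s \<ge> 1 \<Longrightarrow> 4 * exp 1 * \<phi> s \<le> \<phi> (2 ^ m * s)"
    using bernstein_dyadic_multiple[OF bern sv lpos comp] by blast
  have half: "\<phi> s \<le> 2 * \<phi> (s / 2)" if "s > 0" for s
    using bernstein_scale[OF bern, of "1 / 2" s] that by simp

  obtain C1 where C1: "C1 > 0" "\<And>x :: 'a. x \<in> D \<Longrightarrow>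
      (\<integral>\<^sup>+t. ennreal (indicator {0<..} t * heat_kernel t x) \<partial>U) \<le> ennreal (C1 * g x)"
    by (rule heat_kernel_integral_upper[where 'a = 'a, OF sets_U lap pos K(2,1) \<beta>(3)];
        (assumption | (erule that, simp add: D_def g_def)))
  obtain C2 where C2: "C2 > 0" "\<And>x :: 'a. x \<in> D \<Longrightarrow>
      ennreal (g x) \<le> ennreal C2 * (\<integral>\<^sup>+t. ennreal (indicator {0<..} t * heat_kernel t x) \<partial>U)"
    by (rule heat_kernel_integral_lower[where 'a = 'a, OF sets_U U_nonneg lap pos half m];
        (assumption | (erule that, simp add: D_def g_def)))
  have g_pos: "g x > 0" if "x \<in> D" for x using that pos by (auto simp: g_def D_def)
  have G: "(\<integral>\<^sup>+t. ennreal (indicator {0<..} t * heat_kernel t x) \<partial>U) = ennreal (G x)" "0 \<le> G x"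
    if "x \<in> D" for x
  proof -
    have "G x = enn2real (\<integral>\<^sup>+t. ennreal (indicator {0<..} t * heat_kernel t x) \<partial>U)"
      unfolding G_def green_function_def set_lebesgue_integral_def U_def[symmetric]
      by (subst integral_eq_nn_integral) (measurable, auto simp: heat_kernel_nonneg)
    moreover have "(\<integral>\<^sup>+t. ennreal (indicator {0<..} t * heat_kernel t x) \<partial>U) < \<infinity>"
      using C1(2)[OF that] by (rule le_less_trans) simp
    ultimately show "(\<integral>\<^sup>+t. ennreal (indicator {0<..} t * heat_kernel t x) \<partial>U) = ennreal (G x)" "0 \<le> G x"
      by auto
  qed
  have "comparable_on D G g"
  proof (rule comparable_onI)
    fix x assume x: "x \<in> D"
    show "g x > 0" by (rule g_pos[OF x])
    show "G x \<le> C1 * g x"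
      using C1 C1(2)[OF x] G[OF x] g_pos[OF x] by (simp add: ennreal_le_iff)
    show "g x \<le> C2 * G x"
      using C2 C2(2)[OF x] G[OF x] by (simp add: ennreal_mult[symmetric] ennreal_le_iff)
  qed (rule C2(1))
  moreover have "comparable_on D g h"
  proof (rule comparable_onI)
    fix x assume "x \<in> D"
    then have x: "0 < norm x" "norm x \<le> 1" by (auto simp: D_def)
    define s where "s = 1 / (norm x)\<^sup>2"
    have s: "s \<ge> 1" using x by (simp add: s_def power_le_one)
    have "s powr (\<alpha> / 2) = 1 / ((norm x)\<^sup>2) powr (\<alpha> / 2)"
      unfolding s_def powr_divide by simp
    also have "((norm x)\<^sup>2) powr (\<alpha> / 2) = (norm x powr 2) powr (\<alpha> / 2)" using x by simp
    also have "\<dots> = norm x powr \<alpha>" unfolding powr_powr by simp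
    finally have "norm x ^ DIM('a) * s powr (\<alpha> / 2) = norm x powr (real DIM('a) - \<alpha>)"
      using x by (simp add: powr_diff powr_realpow)
    then have h: "h x = 1 / (norm x ^ DIM('a) * (s powr (\<alpha> / 2) * l s))"
      by (simp add: h_def s_def mult.assoc[symmetric])
    have g: "g x = 1 / (norm x ^ DIM('a) * \<phi> s)" by (simp add: g_def s_def)
    have q: "s powr (\<alpha> / 2) * l s > 0" "\<phi> s > 0" using s lpos[of s] c(4)[OF s] by auto
    show "h x > 0" unfolding h using q x by simp
    have frac: "1 / (a * u) \<le> c * (1 / (a * v))" if "v \<le> c * u" "a > 0" "u > 0" "v > 0" for a u v :: real
      using that by (simp add: field_simps)
    show "g x \<le> c * h x" unfolding g h by (rule frac) (use c(3)[OF s] q x in auto)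
    show "h x \<le> c * g x" unfolding g h by (rule frac) (use c(2)[OF s] q x in auto)
  qed (use c(1) in simp)
  ultimately show ?thesis unfolding G_def D_def g_def h_def ..
qed

end
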